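(* Let $(n_k)_{k\ge 0}$ be a strictly increasing sequence of positive integers with $n_0=1$. The following assertions are equivalent: (i) $(n_k)_{k\ge 0}$ is NSS for the class of (real or complex) linear Banach-Lie groups; (ii) $(n_k)_{k\ge 0}$ is a Jamison sequence.
   Context: Let $(n_k)_{k\ge 0}$ be a strictly increasing sequence of positive integers with $n_0=1$. A real (resp. complex) linear Banach-Lie group is here a topological group $G$ for which there exists an injective continuous homomorphism from $G$ into the group of invertible elements of a real (resp. complex) unital Banach algebra $A$ (with the norm topology). For a topological group $G$, $(G,(n_k)_{k\ge 0})$ is NSS if there exists a neighborhood $U$ of the identity $e$ of $G$ such that, for $g\in G$, if $g^{n_k}\in U$ for every $k\ge 0$, then $g=e$. The sequence $(n_k)_{k\ge 0}$ is NSS for a class $\mathcal{C}$ of topological groups if $(G,(n_k)_{k\ge 0})$ is NSS for each $G$ in $\mathcal{C}$ (the neighborhood may depend on $G$). $(n_k)_{k\ge 0}$ is a Jamison sequence if for every bounded linear operator $T$ on a complex separable Banach space such that $\sup_{k\ge 0}\|T^{n_k}\|<+\infty$, the set of eigenvalues of $T$ of modulus $1$ is (at most) countable. *)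

theory Defs
  imports
    "HOL-Analysis.Analysis"
    "HOL-Library.Equipollence"
    "HOL-Algebra.Algebraic_Closure_Type"
begin

text \<open>
  Statements of the form ``for every Banach space'' or ``for every Banach algebra'' occur below
  inside formulas, where one cannot quantify over types.  Groups, Banach spaces and Banach
  algebras are therefore structures with an explicit carrier, and each quantifier ranges over all
  structures whose carrier is a subset of a type which serves as universe.

  The scalar field is a type \<open>'k\<close> and is used only with real and complex numbers.
  A vector space over \<open>'k\<close> is a module in the sense of HOL-Algebra over the ring
  \<^term>\<open>ring_of_type_algebra :: 'k::real_normed_field ring\<close>.  The fields for multiplication
  and unit, which every module record has, are irrelevant for vector spaces; they carry
  the multiplication of an algebra.
\<close>

text \<open>The value off the carrier is set to 0 since \<^locale>\<open>Metric_space\<close> requires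
  symmetry and nonnegativity of the distance on the whole type.\<close>

definition norm_dist :: "('k, 'a) module \<Rightarrow> ('a \<Rightarrow> real) \<Rightarrow> 'a \<Rightarrow> 'a \<Rightarrow> real" where
  "norm_dist E N x y =
     (if x \<in> carrier E \<and> y \<in> carrier E then N (x \<ominus>\<^bsub>E\<^esub> y) else 0)"

definition norm_topology :: "('k, 'a) module \<Rightarrow> ('a \<Rightarrow> real) \<Rightarrow> 'a topology" where
  "norm_topology E N = Metric_space.mtopology (carrier E) (norm_dist E N)"

locale normed_space =
  Module.module "ring_of_type_algebra :: 'k ring" E
  for E :: "('k::real_normed_field, 'a) module" (structure) +
  fixes N :: "'a \<Rightarrow> real"
  assumes N_nonneg: "x \<in> carrier E \<Longrightarrow> 0 \<le> N x"
    and N_eq_0_iff: "x \<in> carrier E \<Longrightarrow> N x = 0 \<longleftrightarrow> x = \<zero>"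
    and N_smult: "x \<in> carrier E \<Longrightarrow> N (a \<odot> x) = norm a * N x"
    and N_triangle: "\<lbrakk>x \<in> carrier E; y \<in> carrier E\<rbrakk> \<Longrightarrow> N (x \<oplus> y) \<le> N x + N y"

lemma (in normed_space) Metric_space_norm_dist: "Metric_space (carrier E) (norm_dist E N)"
proof -
  have neg: "N (y \<ominus> x) = N (x \<ominus> y)" if "x \<in> carrier E" "y \<in> carrier E" for x y
  proof -
    have u: "(-1) \<in> carrier (ring_of_type_algebra :: 'k ring)" by (simp add: ring_of_type_algebra_def)
    have "(-1) \<odot> z = \<ominus> z" if "z \<in> carrier E" for z
    proof -
      have "z \<oplus> (-1) \<odot> z = (1 \<oplus>\<^bsub>(ring_of_type_algebra :: 'k ring)\<^esub> (-1)) \<odot> z"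
        using smult_l_distr[of 1 "-1" z] smult_one[OF that] that by (simp add: ring_of_type_algebra_def)
      also have "\<dots> = \<zero>" using smult_l_null[OF that] by (simp add: ring_of_type_algebra_def)
      finally show ?thesis using that u smult_closed by (metis add.inv_equality add.m_comm)
    qed
    moreover have "y \<ominus> x = \<ominus> (x \<ominus> y)" using that 
      by (simp add: minus_add add.m_comm a_minus_def)
    ultimately show ?thesis using that N_smult[of "x \<ominus> y" "-1"] by simp
  qed
  show ?thesis
  proof
    fix x y z assume a: "x \<in> carrier E" "y \<in> carrier E" 
    show "norm_dist E N x y = 0 \<longleftrightarrow> x = y" using a by (simp add: norm_dist_def N_eq_0_iff) (metis minus_equality minus_minus a_inv_closed r_neg a_minus_def)
    assume "z \<in> carrier E"
    then have "x \<ominus> z = (x \<ominus> y) \<oplus> (y \<ominus> z)" using a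
      by (simp add: a_minus_def add.m_assoc add.inv_solve_left r_neg1)
    then show "norm_dist E N x z \<le> norm_dist E N x y + norm_dist E N y z" 
      using a \<open>z \<in> _\<close> N_triangle[of "x \<ominus> y" "y \<ominus> z"] by (simp add: norm_dist_def)
  qed (auto simp: norm_dist_def N_nonneg neg)
qed

locale banach_space = normed_space E N
  for E :: "('k::real_normed_field, 'a) module" (structure) and N +
  assumes complete: "Metric_space.mcomplete (carrier E) (norm_dist E N)"

locale unital_banach_algebra = banach_space A N + ring A
  for A :: "('k::real_normed_field, 'a) module" (structure) and N +
  assumes smult_mult_left:
      "\<lbrakk>x \<in> carrier A; y \<in> carrier A\<rbrakk> \<Longrightarrow> (a \<odot> x) \<otimes> y = a \<odot> (x \<otimes> y)"
    and smult_mult_right: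
      "\<lbrakk>x \<in> carrier A; y \<in> carrier A\<rbrakk> \<Longrightarrow> x \<otimes> (a \<odot> y) = a \<odot> (x \<otimes> y)"
    and N_mult: "\<lbrakk>x \<in> carrier A; y \<in> carrier A\<rbrakk> \<Longrightarrow> N (x \<otimes> y) \<le> N x * N y"
    and N_one: "N \<one> = 1"

locale topological_group = group G
  for G :: "'g monoid" (structure) +
  fixes \<tau> :: "'g topology"
  assumes topspace_eq: "topspace \<tau> = carrier G"
    and continuous_mult: "continuous_map (prod_topology \<tau> \<tau>) \<tau> (\<lambda>(x, y). x \<otimes> y)"
    and continuous_inv: "continuous_map \<tau> \<tau> (\<lambda>x. inv x)"

definition linear_banach_lie_group ::
  "'k::real_normed_field itself \<Rightarrow> 'a itself \<Rightarrow> 'g monoid \<Rightarrow> 'g topology \<Rightarrow> bool" where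
  "linear_banach_lie_group _ _ G \<tau> \<longleftrightarrow>
     topological_group G \<tau> \<and>
     (\<exists>(A :: ('k, 'a) module) N \<phi>.
        unital_banach_algebra A N \<and>
        \<phi> \<in> hom G (units_of A) \<and>
        inj_on \<phi> (carrier G) \<and>
        continuous_map \<tau> (subtopology (norm_topology A N) (Units A)) \<phi>)"

definition nss :: "'g monoid \<Rightarrow> 'g topology \<Rightarrow> (nat \<Rightarrow> nat) \<Rightarrow> bool" where
  "nss G \<tau> n \<longleftrightarrow>
     (\<exists>U. U \<subseteq> carrier G \<and> (\<exists>V. openin \<tau> V \<and> \<one>\<^bsub>G\<^esub> \<in> V \<and> V \<subseteq> U) \<and>
        (\<forall>g \<in> carrier G. (\<forall>k. g [^]\<^bsub>G\<^esub> n k \<in> U) \<longrightarrow> g = \<one>\<^bsub>G\<^esub>))"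

definition nss_for_linear_banach_lie_groups ::
  "'g itself \<Rightarrow> 'a itself \<Rightarrow> (nat \<Rightarrow> nat) \<Rightarrow> bool" where
  "nss_for_linear_banach_lie_groups _ _ n \<longleftrightarrow>
     (\<forall>(G :: 'g monoid) \<tau>.
        linear_banach_lie_group TYPE(real) TYPE('a) G \<tau> \<or>
        linear_banach_lie_group TYPE(complex) TYPE('a) G \<tau> \<longrightarrow> nss G \<tau> n)"

definition bounded_linear_operator ::
  "('k::real_normed_field, 'a) module \<Rightarrow> ('a \<Rightarrow> real) \<Rightarrow> ('a \<Rightarrow> 'a) \<Rightarrow> bool" where
  "bounded_linear_operator E N T \<longleftrightarrow>
     T \<in> carrier E \<rightarrow> carrier E \<and>
     (\<forall>x \<in> carrier E. \<forall>y \<in> carrier E. T (x \<oplus>\<^bsub>E\<^esub> y) = T x \<oplus>\<^bsub>E\<^esub> T y) \<and>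
     (\<forall>a. \<forall>x \<in> carrier E. T (a \<odot>\<^bsub>E\<^esub> x) = a \<odot>\<^bsub>E\<^esub> T x) \<and>
     (\<exists>C. \<forall>x \<in> carrier E. N (T x) \<le> C * N x)"

text \<open>As in the definition of \<^const>\<open>onorm\<close>, the zero vector contributes
  the value \<open>0 / 0 = 0\<close> to the supremum.\<close>

definition operator_norm ::
  "('k, 'a) module \<Rightarrow> ('a \<Rightarrow> real) \<Rightarrow> ('a \<Rightarrow> 'a) \<Rightarrow> real" where
  "operator_norm E N T = (SUP x \<in> carrier E. N (T x) / N x)"

definition eigenvalues :: "('k, 'a) module \<Rightarrow> ('a \<Rightarrow> 'a) \<Rightarrow> 'k set" where
  "eigenvalues E T = {c. \<exists>x \<in> carrier E. x \<noteq> \<zero>\<^bsub>E\<^esub> \<and> T x = c \<odot>\<^bsub>E\<^esub> x}"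

definition jamison_sequence :: "'b itself \<Rightarrow> (nat \<Rightarrow> nat) \<Rightarrow> bool" where
  "jamison_sequence _ n \<longleftrightarrow>
     (\<forall>(E :: (complex, 'b) module) N T.
        banach_space E N \<and> separable_space (norm_topology E N) \<and>
        bounded_linear_operator E N T \<and>
        bdd_above (range (\<lambda>k. operator_norm E N (T ^^ n k))) \<longrightarrow>
        countable {c \<in> eigenvalues E T. norm c = 1})"

end

theory Submission
  imports Defs
begin

text \<open>
  Both assertions are equivalent to a condition on the circle alone, \<open>circle_nss n\<close>: there is
  \<open>\<epsilon> > 0\<close> such that \<open>z = 1\<close> is the only unimodular \<open>z\<close> with \<open>cmod (z ^ n k - 1) < \<epsilon>\<close> for all \<open>k\<close>.
  The first assertion implies it because the circle is the unitary group of the one-dimensional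
  Banach algebra.

  The circle condition implies the first assertion by spectral theory.  If all powers
  \<open>a ^ n k\<close> of a unit \<open>a\<close> are close to 1, then \<open>z ^ n k\<close> is close to 1 for every spectral value \<open>z\<close>
  and every \<open>k\<close>, which forces \<open>z = 1\<close>; hence \<open>a - 1\<close> is quasinilpotent (\<open>quasinilpotent\<close>).
  But then \<open>a\<close> is recovered from \<open>a ^ m\<close>, where \<open>m = n k\<close>, by the binomial series of the
  \<open>m\<close>-th root, all of whose nonconstant coefficients are at most \<open>1 / m\<close> in absolute value.
  Thus the norm of \<open>a - 1\<close> is at most \<open>2 / m\<close> (\<open>quasinilpotent_le_of_power\<close>), and \<open>m\<close> is
  arbitrarily large.  Only polynomials in \<open>a\<close> matter, so the argument is carried out for a
  submultiplicative seminorm on complex polynomials, with approximate inverses in place of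
  inverses.  This form covers real algebras too: the real and the imaginary part of a complex
  polynomial can be evaluated at \<open>a\<close> separately.

  The circle condition implies the Jamison property because it keeps unit eigenvectors for distinct
  unimodular eigenvalues a fixed distance apart, while a separable space has no uncountable
  uniformly discrete subset (\<open>circle_nss_imp_jamison_sequence\<close>).

  Conversely, suppose that the circle condition fails.  Measure the distance of unimodular \<open>z\<close>
  and \<open>w\<close> by the supremum of \<open>cmod (z ^ n k - w ^ n k)\<close> over \<open>k\<close>.  By assumption this metric has
  points arbitrarily close to 1, and the monoid \<open>C\<close> generated by a sequence of them that tends to 1 is a
  countable set without isolated points.  Its closure is a perfect set, hence
  uncountable.  On sequences with the weights \<open>2 ^ (- l m)\<close>, where \<open>l m\<close> is the least number of terms
  in a representation of \<open>m\<close> as a sum of members of the sequence \<open>n\<close>, the left shift \<open>T\<close> satisfies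
  \<open>norm (T ^ n k) \<le> 2\<close>, because passing from \<open>m\<close> to \<open>m + n k\<close> costs at most one more term.
  The geometric sequence of \<open>z\<close> is an eigenvector
  for the eigenvalue \<open>z\<close> and depends continuously on \<open>z\<close> for the above metric.  So on the
  separable closed span of the eigenvectors for \<open>C\<close> the shift has all
  points of the closure of \<open>C\<close> as eigenvalues (\<open>not_jamison_if_not_circle_nss\<close>).
\<close>

unbundle no vec_syntax
unbundle fps_syntax
hide_const (open) up_ring.coeff up_ring.monom Polynomials.degree

section \<open>Quasinilpotency under a seminorm on complex polynomials\<close>

lemma smult_sum_right: "Polynomial.smult c (\<Sum>i\<in>I. f i) = (\<Sum>i\<in>I. Polynomial.smult c (f i))"
  by (induction I rule: infinite_finite_induct) (simp_all add: smult_add_right)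

text \<open>
  The intended seminorm is \<open>p \<mapsto> N (p a)\<close> for an element \<open>a\<close> of a Banach algebra.  The
  factor 2 leaves room for real algebras, where the seminorm is
  \<open>N (Re p a) + N (Im p a)\<close> and a constant \<open>c\<close> has seminorm \<open>\<bar>Re c\<bar> + \<bar>Im c\<bar>\<close>.
\<close>

locale poly_seminorm =
  fixes \<nu> :: "complex poly \<Rightarrow> real"
  assumes nonneg: "0 \<le> \<nu> p"
    and add_le: "\<nu> (p + q) \<le> \<nu> p + \<nu> q"
    and mult_le: "\<nu> (p * q) \<le> \<nu> p * \<nu> q"
    and const_le: "\<nu> [:c:] \<le> 2 * cmod c"
begin

lemma zero [simp]: "\<nu> 0 = 0"
  using const_le[of 0] nonneg[of 0] by simp

lemma one_le: "\<nu> 1 \<le> 2"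
  using const_le[of 1] by (simp add: one_pCons)

lemma smult_le: "\<nu> (Polynomial.smult c p) \<le> 2 * cmod c * \<nu> p"
proof -
  have "\<nu> (Polynomial.smult c p) = \<nu> ([:c:] * p)" by simp
  also have "\<dots> \<le> \<nu> [:c:] * \<nu> p" by (rule mult_le)
  also have "\<dots> \<le> 2 * cmod c * \<nu> p" by (intro mult_right_mono const_le nonneg)
  finally show ?thesis .
qed

lemma sum_le: "\<nu> (\<Sum>i\<in>I. f i) \<le> (\<Sum>i\<in>I. \<nu> (f i))"
  by (induction I rule: infinite_finite_induct) (auto intro: order_trans[OF add_le])

lemma power_le: "\<nu> (p ^ k) \<le> 2 * \<nu> p ^ k"
proof (induction k)
  case (Suc k)
  have "\<nu> (p ^ Suc k) \<le> \<nu> p * \<nu> (p ^ k)" by (simp add: mult_le)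
  also have "\<dots> \<le> \<nu> p * (2 * \<nu> p ^ k)" by (intro mult_left_mono Suc nonneg)
  finally show ?case by simp
qed (simp add: one_le)

lemma power_Suc_le: "\<nu> (p ^ Suc k) \<le> \<nu> p ^ Suc k"
proof (induction k)
  case (Suc k)
  have "\<nu> (p ^ Suc (Suc k)) \<le> \<nu> p * \<nu> (p ^ Suc k)" using mult_le[of p "p ^ Suc k"] by simp
  also have "\<dots> \<le> \<nu> p * \<nu> p ^ Suc k" by (intro mult_left_mono Suc nonneg)
  finally show ?case by simp
qed simp

definition growth_le :: "complex poly \<Rightarrow> real \<Rightarrow> bool" where
  "growth_le p s \<longleftrightarrow> (\<exists>C. \<forall>k. \<nu> (p ^ k) \<le> C * s ^ k)"

text \<open>
  One good power determines the exponential growth of all powers: write an exponent as a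
  multiple of \<open>m\<close> plus a remainder.
\<close>

lemma growth_leI:
  assumes "m > 0" "s > 0" "\<nu> (p ^ m) \<le> s ^ m"
  shows "growth_le p s"
proof -
  define C where "C = (\<Sum>l<m. \<nu> (p ^ l) / s ^ l)"
  have C0: "0 \<le> C" unfolding C_def using assms nonneg by (intro sum_nonneg) simp
  have "\<nu> (p ^ k) \<le> (2 * C) * s ^ k" for k
  proof -
    let ?l = "k mod m" and ?q = "k div m"
    have l: "?l < m" using assms by simp
    have "\<nu> (p ^ ?l) / s ^ ?l \<le> C"
      unfolding C_def using l assms nonneg
      by (intro member_le_sum[where f = "\<lambda>l. \<nu> (p ^ l) / s ^ l"]) auto
    then have r: "\<nu> (p ^ ?l) \<le> C * s ^ ?l" using assms by (simp add: field_simps)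
    have k: "k = m * ?q + ?l" by simp
    have "\<nu> (p ^ k) = \<nu> ((p ^ m) ^ ?q * p ^ ?l)"
      by (metis k power_add power_mult)
    also have "\<dots> \<le> \<nu> ((p ^ m) ^ ?q) * \<nu> (p ^ ?l)" by (rule mult_le)
    also have "\<dots> \<le> (2 * (s ^ m) ^ ?q) * (C * s ^ ?l)"
    proof (intro mult_mono r nonneg)
      have "\<nu> ((p ^ m) ^ ?q) \<le> 2 * \<nu> (p ^ m) ^ ?q" by (rule power_le)
      also have "\<dots> \<le> 2 * (s ^ m) ^ ?q"
        using assms nonneg by (intro mult_left_mono power_mono) auto
      finally show "\<nu> ((p ^ m) ^ ?q) \<le> 2 * (s ^ m) ^ ?q" .
    qed (use assms in auto)
    also have "\<dots> = (2 * C) * s ^ (m * ?q + ?l)" by (simp only: power_add power_mult mult_ac)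
    finally show ?thesis using k by simp
  qed
  then show ?thesis unfolding growth_le_def by blast
qed

lemma growth_le_mono:
  assumes "growth_le p s" "0 \<le> s" "s \<le> t"
  shows "growth_le p t"
proof -
  obtain C where C: "\<And>k. \<nu> (p ^ k) \<le> C * s ^ k"
    using assms(1) unfolding growth_le_def by blast
  have "0 \<le> C" using C[of 0] nonneg[of 1] by simp
  then have "C * s ^ k \<le> C * t ^ k" for k using assms by (intro mult_left_mono power_mono) auto
  then show ?thesis unfolding growth_le_def using C order_trans by blast
qed

text \<open>
  These are the partial sums of the Neumann series for the inverse of \<open>1 - u * Y\<close>.
\<close>

definition neumann_sum :: "complex poly \<Rightarrow> nat \<Rightarrow> complex \<Rightarrow> complex poly" where
  "neumann_sum Y K u = (\<Sum>j<K. Polynomial.smult (u ^ j) (Y ^ j))"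

lemma neumann_sum_mult: "neumann_sum Y K u * (1 - Polynomial.smult u Y) = 1 - Polynomial.smult (u ^ K) (Y ^ K)"
proof -
  have "neumann_sum Y K u = (\<Sum>j<K. Polynomial.smult u Y ^ j)" by (simp add: neumann_sum_def smult_power)
  then show ?thesis
    using one_diff_power_eq[of "Polynomial.smult u Y" K] by (simp add: mult.commute smult_power)
qed

text \<open>
  An approximate inverse \<open>p\<close> of \<open>1 - u * Y\<close> controls the Neumann sums, since they approximate
  the same inverse.
\<close>

lemma neumann_sum_bound:
  assumes "\<nu> (1 - (1 - Polynomial.smult u Y) * p) \<le> 1/2" "\<nu> (Polynomial.smult (u ^ K) (Y ^ K)) \<le> 1"
  shows "\<nu> (neumann_sum Y K u) \<le> 8 * \<nu> p"
proof -
  let ?R = "neumann_sum Y K u"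
  have "?R = ?R * (1 - (1 - Polynomial.smult u Y) * p) + p * (?R * (1 - Polynomial.smult u Y))"
    by (simp add: algebra_simps)
  also have "\<dots> = ?R * (1 - (1 - Polynomial.smult u Y) * p) + p * (1 + Polynomial.smult (-1) (Polynomial.smult (u ^ K) (Y ^ K)))"
    by (simp add: neumann_sum_mult)
  finally have "\<nu> ?R \<le> \<nu> ?R * \<nu> (1 - (1 - Polynomial.smult u Y) * p)
     + \<nu> p * (\<nu> 1 + \<nu> (Polynomial.smult (-1) (Polynomial.smult (u ^ K) (Y ^ K))))"
    using add_le mult_le nonneg
    by (smt (verit, best) mult_left_mono)
  also have "\<dots> \<le> \<nu> ?R * (1/2) + \<nu> p * (2 + 2)"
  proof (intro add_mono mult_left_mono assms one_le nonneg)
    show "\<nu> (Polynomial.smult (- 1) (Polynomial.smult (u ^ K) (Y ^ K))) \<le> 2"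
      using smult_le[of "-1" "Polynomial.smult (u ^ K) (Y ^ K)"] assms(2) by simp
  qed
  finally show ?thesis by simp
qed

text \<open>
  Approximate invertibility is an open condition on \<open>u\<close>, so compactness of the circle of radius
  \<open>1 / r\<close> turns it into one bound for all \<open>u\<close> in a thin annulus inside that circle.
\<close>

lemma neumann_sum_bound_annulus:
  assumes r: "r > 0"
    and inv: "\<And>u. cmod u = 1 / r \<Longrightarrow> \<exists>p. \<nu> (1 - (1 - Polynomial.smult u Y) * p) \<le> 1/4"
  obtains M \<eta> where "M \<ge> 0" "\<eta> > 0"
    "\<And>u K. \<lbrakk>1 / r - \<eta> < cmod u; cmod u < 1 / r; u \<noteq> 0; \<nu> (Polynomial.smult (u ^ K) (Y ^ K)) \<le> 1\<rbrakk>
       \<Longrightarrow> \<nu> (neumann_sum Y K u) \<le> M"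
proof -
  obtain P where P: "\<And>u. cmod u = 1 / r \<Longrightarrow> \<nu> (1 - (1 - Polynomial.smult u Y) * P u) \<le> 1/4"
    using inv by metis
  define e where "e u = 1 / (16 * (\<nu> (Y * P u) + 1))" for u
  have e: "e u > 0" for u using nonneg[of "Y * P u"] unfolding e_def by simp
  have "compact (sphere (0::complex) (1 / r))" by simp
  moreover have "sphere (0::complex) (1 / r) \<subseteq> (\<Union>u\<in>sphere 0 (1 / r). ball u (e u))"
    using e by force
  ultimately obtain F where F: "F \<subseteq> sphere (0::complex) (1 / r)" "finite F"
    and cover: "sphere (0::complex) (1 / r) \<subseteq> (\<Union>u\<in>F. ball u (e u))"
    using compactE_image[of "sphere (0::complex) (1 / r)" "sphere (0::complex) (1 / r)" "\<lambda>u. ball u (e u)" thesis]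
    by (simp only: open_ball)
  define \<eta> where "\<eta> = Min (insert 1 (e ` F))"
  define M where "M = (\<Sum>u\<in>F. 8 * \<nu> (P u))"
  show thesis
  proof (rule that)
    show "M \<ge> 0" unfolding M_def using nonneg by (intro sum_nonneg) auto
    show "\<eta> > 0" unfolding \<eta>_def using F e by (subst Min_gr_iff) auto
    fix u K assume u: "1 / r - \<eta> < cmod u" "cmod u < 1 / r" "u \<noteq> 0"
      and K: "\<nu> (Polynomial.smult (u ^ K) (Y ^ K)) \<le> 1"
    \<comment> \<open>the radial projection of u to the circle\<close>
    define v where "v = of_real (1 / (r * cmod u)) * u"
    have v: "v \<in> sphere 0 (1 / r)" using u r by (simp add: v_def norm_mult norm_divide)
    then obtain w where w: "w \<in> F" "dist w v < e w" using cover by auto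
    have "v - u = of_real (1 / (r * cmod u) - 1) * u" by (simp add: v_def algebra_simps)
    then have "cmod (v - u) = \<bar>1 / (r * cmod u) - 1\<bar> * cmod u" by (metis norm_mult norm_of_real)
    also have "\<dots> = 1 / r - cmod u"
    proof -
      have "1 / (r * cmod u) \<ge> 1" using u r by (simp add: field_simps)
      then show ?thesis using u r by (simp add: field_simps)
    qed
    also have "\<dots> < \<eta>" using u by simp
    also have "\<eta> \<le> e w" unfolding \<eta>_def using w F by (intro Min_le) auto
    finally have "cmod (u - w) < 2 * e w" using w
      by (smt (verit) dist_norm norm_minus_commute norm_triangle_sub dist_triangle)
    have "1 - (1 - Polynomial.smult u Y) * P w = (1 - (1 - Polynomial.smult w Y) * P w) + Polynomial.smult (u - w) (Y * P w)"
      by (simp add: algebra_simps smult_diff_left)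
    then have "\<nu> (1 - (1 - Polynomial.smult u Y) * P w) \<le> \<nu> (1 - (1 - Polynomial.smult w Y) * P w) + \<nu> (Polynomial.smult (u - w) (Y * P w))"
      using add_le by metis
    also have "\<dots> \<le> 1/4 + 2 * cmod (u - w) * \<nu> (Y * P w)"
      using P[of w] w F by (intro add_mono smult_le) auto
    also have "\<dots> \<le> 1/4 + 2 * (2 * e w) * \<nu> (Y * P w)"
      using \<open>cmod (u - w) < 2 * e w\<close> nonneg by (intro add_left_mono mult_right_mono) auto
    also have "\<dots> \<le> 1/2" using nonneg[of "Y * P w"] by (simp add: e_def field_simps)
    finally have "\<nu> (neumann_sum Y K u) \<le> 8 * \<nu> (P w)" using K by (rule neumann_sum_bound)
    also have "\<dots> \<le> M" unfolding M_def using w F nonneg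
      by (intro member_le_sum[where f = "\<lambda>w. 8 * \<nu> (P w)"]) auto
    finally show "\<nu> (neumann_sum Y K u) \<le> M" .
  qed
qed

text \<open>
  A discrete Cauchy formula.  The square of the Neumann series is
  \<open>\<Sum>k. (k + 1) * u ^ k * Y ^ k\<close>, and averaging over roots of unity isolates one
  term.  Since the squared partial sum has degree below \<open>2 * K\<close>, the \<open>2 * K\<close>-th
  roots of unity separate all its terms, and the formula is exact.
\<close>

lemma neumann_sum_square_coeff:
  assumes "k < K" and N: "N = 2 * K" and \<omega>: "\<omega> = cis (2 * pi / real N)"
  shows "(\<Sum>m<N. Polynomial.smult (inverse (\<omega> ^ (m * k))) (neumann_sum Y K (\<omega> ^ m * t) ^ 2))
    = Polynomial.smult (of_nat N * of_nat (Suc k) * t ^ k) (Y ^ k)"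
proof -
  have N0: "N > 0" using assms by simp
  have \<omega>0: "\<omega> \<noteq> 0" by (simp add: \<omega>)
  have \<omega>N: "\<omega> ^ N = 1" using N0 Complex.DeMoivre[of "2 * pi / real N" N] by (simp add: \<omega>)
  have prim: "\<omega> ^ l \<noteq> 1" if "0 < l" "l < N" for l
  proof
    assume "\<omega> ^ l = 1"
    then have "cis (real l * (2 * pi / real N)) = 1" by (simp add: \<omega> Complex.DeMoivre)
    then have "cos (real l * (2 * pi / real N)) = 1" by (metis cis.sel(1) one_complex.sel(1))
    then obtain x :: int where "real l * (2 * pi / real N) = of_int x * 2 * pi"
      using cos_one_2pi_int by blast
    then have "real l = of_int x * real N" using N0 by (simp add: field_simps)
    then have "int l = x * int N" by (metis of_int_eq_iff of_int_mult of_int_of_nat_eq)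
    then show False using that
      by (metis dvd_imp_le dvd_triv_right int_dvd_int_iff not_le)
  qed
  have orth: "(\<Sum>m<N. inverse (\<omega> ^ (m * k)) * (\<omega> ^ m) ^ l) = (if l = k then of_nat N else 0)"
    if "l < N" for l
  proof -
    define z where "z = inverse (\<omega> ^ k) * \<omega> ^ l"
    have "(\<Sum>m<N. inverse (\<omega> ^ (m * k)) * (\<omega> ^ m) ^ l) = (\<Sum>m<N. z ^ m)"
      unfolding z_def by (intro sum.cong refl) (simp add: power_mult_distrib power_inverse mult.commute flip: power_mult)
    also have "\<dots> = (if l = k then of_nat N else 0)"
    proof (cases "l = k")
      case True then show ?thesis using \<omega>0 by (simp add: z_def)
    next
      case False
      have z1: "z \<noteq> 1"
      proof
        assume "z = 1"
        then have eq: "\<omega> ^ l = \<omega> ^ k" using \<omega>0 by (simp add: z_def field_simps)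
        have "\<omega> ^ (max l k - min l k) = 1"
        proof -
          have "\<omega> ^ max l k = \<omega> ^ min l k" using eq by (simp add: max_def min_def)
          then show ?thesis using \<omega>0 by (simp add: power_diff)
        qed
        moreover have "0 < max l k - min l k" "max l k - min l k < N"
          using False that \<open>k < K\<close> N by (auto simp: max_def min_def)
        ultimately show False using prim by blast
      qed
      have "z ^ N = 1"
        by (simp add: z_def power_mult_distrib power_inverse \<omega>N flip: power_mult)
           (metis \<omega>N inverse_1 mult.commute mult_1 power_mult power_one)
      then show ?thesis using z1 False by (simp add: geometric_sum)
    qed
    finally show ?thesis .
  qed
  have "(\<Sum>m<N. Polynomial.smult (inverse (\<omega> ^ (m * k))) (neumann_sum Y K (\<omega> ^ m * t) ^ 2))
     = (\<Sum>m<N. \<Sum>i<K. \<Sum>j<K. Polynomial.smult (inverse (\<omega> ^ (m * k)) * (\<omega> ^ m) ^ (i + j)) (Polynomial.smult (t ^ (i + j)) (Y ^ (i + j))))"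
    unfolding neumann_sum_def power2_eq_square sum_product smult_sum_right
    by (intro sum.cong refl) (simp add: power_mult_distrib power_add mult_ac)
  also have "\<dots> = (\<Sum>i<K. \<Sum>j<K. Polynomial.smult (\<Sum>m<N. inverse (\<omega> ^ (m * k)) * (\<omega> ^ m) ^ (i + j)) (Polynomial.smult (t ^ (i + j)) (Y ^ (i + j))))"
    unfolding smult_sum
    by (rule trans[OF sum.swap], rule sum.cong[OF refl], rule sum.swap)
  also have "\<dots> = (\<Sum>i<K. \<Sum>j<K. if i + j = k then Polynomial.smult (of_nat N * t ^ k) (Y ^ k) else 0)"
    using orth N by (intro sum.cong refl) auto
  also have "\<dots> = (\<Sum>i<K. if i \<le> k then Polynomial.smult (of_nat N * t ^ k) (Y ^ k) else 0)"
  proof (intro sum.cong refl)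
    fix i assume "i \<in> {..<K}"
    have "(\<Sum>j<K. if i + j = k then Polynomial.smult (of_nat N * t ^ k) (Y ^ k) else 0)
       = (\<Sum>j<K. if j = k - i then (if i \<le> k then Polynomial.smult (of_nat N * t ^ k) (Y ^ k) else 0) else 0)"
      by (intro sum.cong refl) auto
    also have "\<dots> = (if i \<le> k then Polynomial.smult (of_nat N * t ^ k) (Y ^ k) else 0)"
      using \<open>k < K\<close> by (subst sum.delta) auto
    finally show "(\<Sum>j<K. if i + j = k then Polynomial.smult (of_nat N * t ^ k) (Y ^ k) else 0) = \<dots>" .
  qed
  also have "\<dots> = (\<Sum>i\<le>k. Polynomial.smult (of_nat N * t ^ k) (Y ^ k))"
  proof -
    have "{i \<in> {..<K}. i \<le> k} = {..k}" using \<open>k < K\<close> by auto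
    then show ?thesis by (simp add: sum.If_cases Int_def)
  qed
  also have "\<dots> = Polynomial.smult (of_nat N * of_nat (Suc k) * t ^ k) (Y ^ k)"
    by (simp add: of_nat_poly mult_ac)
  finally show ?thesis .
qed

text \<open>
  The factor \<open>1 / (k + 1)\<close> is the gain over the trivial bound.  It comes from applying the
  Cauchy formula to the square of the resolvent, which stays bounded up to the radius \<open>1 / r\<close>.
\<close>

lemma growth_le_power_bound:
  assumes r: "r > 0" and rate: "\<And>s. s > r \<Longrightarrow> growth_le Y s"
    and inv: "\<And>u. cmod u = 1 / r \<Longrightarrow> \<exists>p. \<nu> (1 - (1 - Polynomial.smult u Y) * p) \<le> 1/4"
  obtains B where "B \<ge> 0" "\<And>k. \<nu> (Y ^ k) \<le> B * r ^ k / real (Suc k)"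
proof -
  obtain M \<eta> where M: "M \<ge> 0" "\<eta> > 0" and neumann_sum: "\<And>u K. \<lbrakk>1 / r - \<eta> < cmod u; cmod u < 1 / r; u \<noteq> 0;
      \<nu> (Polynomial.smult (u ^ K) (Y ^ K)) \<le> 1\<rbrakk> \<Longrightarrow> \<nu> (neumann_sum Y K u) \<le> M"
    using neumann_sum_bound_annulus[OF r inv] by metis
  have bound: "\<nu> (Y ^ k) * t ^ k \<le> 4 * M ^ 2 / real (Suc k)"
    if t: "1 / r - \<eta> < t" "t < 1 / r" "0 < t" for t k
  proof -
    have "r < 1 / t" using t(2,3) r by (simp add: field_simps)
    then obtain s where s1: "r < s" "s < 1 / t" using dense by blast
    then have s: "s > r" "s * t < 1" "s > 0" using r t(3) by (simp_all add: pos_less_divide_eq)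
    obtain C where C: "\<And>k. \<nu> (Y ^ k) \<le> C * s ^ k"
      using rate[OF s(1)] unfolding growth_le_def by blast
    have "(\<lambda>K. (2 * C) * (s * t) ^ K) \<longlonglongrightarrow> (2 * C) * 0"
      by (intro tendsto_intros LIMSEQ_realpow_zero) (use s t(3) in auto)
    then have "\<forall>\<^sub>F K in sequentially. (2 * C) * (s * t) ^ K < 1" by (rule order_tendstoD) simp
    \<comment> \<open>2 * C * (s * t) ^ K bounds the seminorm of u ^ K * Y ^ K whenever cmod u = t\<close>
    then have "\<forall>\<^sub>F K in sequentially. K > k \<and> (2 * C) * (s * t) ^ K < 1"
      by (intro eventually_conj eventually_gt_at_top)
    then obtain K where K: "K > k" "(2 * C) * (s * t) ^ K < 1"
      using eventually_happens'[OF sequentially_bot] by blast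
    define N where "N = 2 * K"
    define \<omega> where "\<omega> = cis (2 * pi / real N)"
    have R: "\<nu> (neumann_sum Y K (\<omega> ^ m * of_real t)) \<le> M" for m
    proof (rule neumann_sum)
      have n: "cmod (\<omega> ^ m * of_real t) = t" using t by (simp add: norm_mult norm_power \<omega>_def)
      show "1 / r - \<eta> < cmod (\<omega> ^ m * of_real t)" "cmod (\<omega> ^ m * of_real t) < 1 / r"
        unfolding n by (fact t)+
      show "\<omega> ^ m * of_real t \<noteq> 0" using n t(3) by (metis norm_zero less_irrefl)
      have "\<nu> (Polynomial.smult ((\<omega> ^ m * of_real t) ^ K) (Y ^ K)) \<le> 2 * t ^ K * \<nu> (Y ^ K)"
        using smult_le[of "(\<omega> ^ m * of_real t) ^ K" "Y ^ K"] n by (simp add: norm_power)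
      also have "\<dots> \<le> 2 * t ^ K * (C * s ^ K)" using C by (intro mult_left_mono) (use t(3) in auto)
      also have "\<dots> = (2 * C) * (s * t) ^ K" by (simp add: power_mult_distrib)
      finally show "\<nu> (Polynomial.smult ((\<omega> ^ m * of_real t) ^ K) (Y ^ K)) \<le> 1" using K by simp
    qed
    define a where "a = complex_of_real (1 / (real N * real (Suc k) * t ^ k))"
    have N0: "N > 0" using K by (simp add: N_def)
    have "Y ^ k = Polynomial.smult a (Polynomial.smult (of_nat N * of_nat (Suc k) * of_real t ^ k) (Y ^ k))"
      using N0 t(3) by (simp add: a_def del: of_nat_Suc)
    also have "\<dots> = Polynomial.smult a (\<Sum>m<N. Polynomial.smult (inverse (\<omega> ^ (m * k)))
        (neumann_sum Y K (\<omega> ^ m * of_real t) ^ 2))"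
      by (simp only: neumann_sum_square_coeff[OF K(1) N_def \<omega>_def])
    finally have "\<nu> (Y ^ k) \<le> 2 * cmod a * \<nu> (\<Sum>m<N. Polynomial.smult (inverse (\<omega> ^ (m * k)))
        (neumann_sum Y K (\<omega> ^ m * of_real t) ^ 2))"
      by (metis smult_le)
    also have "\<dots> \<le> 2 * cmod a * (\<Sum>m<N. \<nu> (Polynomial.smult (inverse (\<omega> ^ (m * k)))
        (neumann_sum Y K (\<omega> ^ m * of_real t) ^ 2)))"
      by (intro mult_left_mono sum_le) auto
    also have "\<dots> \<le> 2 * cmod a * (\<Sum>m<N. 2 * M ^ 2)"
    proof (intro mult_left_mono sum_mono)
      fix m
      have "\<nu> (neumann_sum Y K (\<omega> ^ m * of_real t) ^ 2) \<le> \<nu> (neumann_sum Y K (\<omega> ^ m * of_real t)) ^ 2"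
        by (simp add: power2_eq_square mult_le)
      also have "\<dots> \<le> M ^ 2" using R nonneg by (intro power_mono) auto
      finally show "\<nu> (Polynomial.smult (inverse (\<omega> ^ (m * k))) (neumann_sum Y K (\<omega> ^ m * of_real t) ^ 2)) \<le> 2 * M ^ 2"
        using smult_le[of "inverse (\<omega> ^ (m * k))" "neumann_sum Y K (\<omega> ^ m * of_real t) ^ 2"]
        by (simp add: norm_inverse norm_power \<omega>_def)
    qed auto
    also have "\<dots> = 4 * M ^ 2 / (real (Suc k) * t ^ k)"
      using N0 t(3) by (simp add: a_def norm_divide norm_mult norm_power field_simps del: of_nat_Suc)
    finally show ?thesis using t(3) by (simp add: field_simps del: of_nat_Suc)
  qed
  show thesis
  proof (rule that[of "4 * M ^ 2"])
    fix k
    have "((\<lambda>t. \<nu> (Y ^ k) * t ^ k) \<longlongrightarrow> \<nu> (Y ^ k) * (1 / r) ^ k) (at_left (1 / r))"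
      by (intro tendsto_intros)
    moreover have "\<forall>\<^sub>F t in at_left (1 / r). \<nu> (Y ^ k) * t ^ k \<le> 4 * M ^ 2 / real (Suc k)"
    proof -
      have "max 0 (1 / r - \<eta>) < 1 / r" using M r by simp
      then have "\<forall>\<^sub>F t in at_left (1 / r). t \<in> {max 0 (1 / r - \<eta>)<..<1 / r}"
        by (rule eventually_at_left_real)
      then show ?thesis by eventually_elim (rule bound, auto)
    qed
    ultimately have "\<nu> (Y ^ k) * (1 / r) ^ k \<le> 4 * M ^ 2 / real (Suc k)"
      by (intro tendsto_upperbound) auto
    then show "\<nu> (Y ^ k) \<le> 4 * M ^ 2 * r ^ k / real (Suc k)"
      using r by (simp add: field_simps power_divide del: of_nat_Suc)
  qed auto
qed

text \<open>
  This replaces the theorem that the spectral radius is attained on the spectrum.  If the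
  optimal growth rate \<open>r\<close> were positive, then the previous lemma would give
  \<open>\<nu> (Y ^ k) \<le> r ^ k / 2\<close> for some \<open>k\<close>, and hence a growth rate below \<open>r\<close>.
\<close>

lemma quasinilpotent:
  assumes inv: "\<And>u. u \<noteq> 0 \<Longrightarrow> \<exists>p. \<nu> (1 - (1 - Polynomial.smult u Y) * p) \<le> 1/4"
    and "s > 0"
  shows "growth_le Y s"
proof -
  define S where "S = {s. s > 0 \<and> growth_le Y s}"
  define r where "r = Inf S"
  have "max 1 (\<nu> Y) \<in> S"
    using growth_leI[of 1 "max 1 (\<nu> Y)" Y] by (auto simp: S_def)
  then have ne: "S \<noteq> {}" by blast
  have bdd: "bdd_below S" by (rule bdd_belowI[of _ 0]) (auto simp: S_def)
  have r0: "r \<ge> 0" unfolding r_def using ne by (intro cInf_greatest) (auto simp: S_def)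
  have rate: "growth_le Y t" if "t > r" for t
    using that ne bdd growth_le_mono unfolding r_def
    by (subst (asm) cInf_less_iff) (auto simp: S_def)
  have "r = 0"
  proof (rule ccontr)
    assume "r \<noteq> 0"
    then have r: "r > 0" using r0 by simp
    have inv_circle: "\<exists>p. \<nu> (1 - (1 - Polynomial.smult u Y) * p) \<le> 1/4" if "cmod u = 1 / r" for u
    proof (rule inv)
      show "u \<noteq> 0" using that r by auto
    qed
    obtain B where B: "B \<ge> 0" "\<And>k. \<nu> (Y ^ k) \<le> B * r ^ k / real (Suc k)"
      using growth_le_power_bound[OF r rate inv_circle] by blast
    obtain k where k: "k > 0" "2 * B < real k" using reals_Archimedean2[of "max 0 (2 * B)"] by auto
    have half: "\<nu> (Y ^ k) \<le> r ^ k / 2"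
    proof -
      have "B * r ^ k / real (Suc k) \<le> r ^ k / 2"
        using mult_right_mono[of "B / real (Suc k)" "1 / 2" "r ^ k"] k(2) r by (simp add: divide_le_eq)
      then show ?thesis by (rule order_trans[OF B(2)])
    qed
    define s where "s = root k (1/2) * r"
    have s: "s > 0" "s < r" using k r by (auto simp: s_def)
    have "s ^ k = r ^ k / 2" using k by (simp add: s_def power_mult_distrib)
    then have "growth_le Y s" using growth_leI[of k s Y] k s half by simp
    then have "r \<le> s" unfolding r_def using s bdd by (intro cInf_lower) (auto simp: S_def)
    then show False using s by simp
  qed
  then show ?thesis using rate assms by simp
qed

end

section \<open>Small powers of quasinilpotent perturbations of the unit\<close>

text \<open>
  The binomial series with exponent \<open>1 / m\<close> inverts the \<open>m\<close>-th power: both sides are \<open>m\<close>-th roots of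
  \<open>(1 + X) ^ m\<close> with constant coefficient 1, and such roots are unique.
\<close>

lemma binomial_root_compose:
  assumes "m > 0"
  shows "fps_binomial (1 / of_nat m) oo ((1 + fps_X) ^ m - 1) = (1 + fps_X :: complex fps)"
proof -
  obtain k where m: "m = Suc k" using assms by (metis gr0_implies_Suc)
  let ?q = "(1 + fps_X) ^ m - 1 :: complex fps"
  let ?r = "\<lambda>(_::nat) (_::complex). 1 :: complex"
  have q0: "?q $ 0 = 0" by (simp add: fps_nth_power_0)
  have b0: "((1 + fps_X :: complex fps) ^ m) $ 0 = 1" by (simp add: fps_nth_power_0)
  have unique: "a = fps_radical ?r (Suc k) ((1 + fps_X) ^ m)"
    if "a ^ Suc k = (1 + fps_X :: complex fps) ^ m" "a $ 0 = 1" for a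
    using radical_unique[of ?r k "(1 + fps_X :: complex fps) ^ m" a] that b0 by simp
  have "(fps_binomial (1 / of_nat m) oo ?q) ^ m = fps_binomial (1 / of_nat m) ^ m oo ?q"
    by (rule fps_compose_power[OF q0])
  also have "\<dots> = (1 + fps_X) oo ?q"
    using assms by (simp add: fps_binomial_power fps_binomial_1)
  also have "\<dots> = (1 + fps_X) ^ m"
    using q0 by (simp add: fps_compose_add_distrib fps_X_fps_compose_startby0)
  finally have "fps_binomial (1 / of_nat m) oo ?q = fps_radical ?r (Suc k) ((1 + fps_X) ^ m)"
    by (intro unique) (simp_all add: m)
  moreover have "1 + fps_X = fps_radical ?r (Suc k) ((1 + fps_X) ^ m)"
    by (intro unique) (simp_all add: m)
  ultimately show ?thesis by metis
qed

lemma norm_binomial_root_coeff_le: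
  assumes "m > 0"
  shows "cmod ((1 / of_nat m) gchoose Suc j) \<le> 1 / real m"
proof (induction j)
  case 0 then show ?case by (simp add: norm_divide)
next
  case (Suc j)
  let ?a = "1 / of_nat m :: complex"
  have "of_nat (Suc (Suc j)) * (?a gchoose Suc (Suc j)) = (?a - of_nat (Suc j)) * (?a gchoose Suc j)"
    using gbinomial_mult_1[of ?a "Suc j"] by (simp add: algebra_simps)
  then have "real (Suc (Suc j)) * cmod (?a gchoose Suc (Suc j)) = cmod (?a - of_nat (Suc j)) * cmod (?a gchoose Suc j)"
    by (metis norm_mult norm_of_nat)
  also have "cmod (?a - of_nat (Suc j)) \<le> real (Suc (Suc j))"
  proof -
    have "cmod ?a \<le> 1" using assms by (simp add: norm_divide)
    then show ?thesis using norm_triangle_ineq4[of ?a "of_nat (Suc j)"]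
      by (simp del: of_nat_Suc add: of_nat_Suc[of "Suc j"])
  qed
  finally have "cmod (?a gchoose Suc (Suc j)) \<le> cmod (?a gchoose Suc j)"
    by (simp add: mult_right_mono del: of_nat_Suc)
  then show ?case using Suc by simp
qed

text \<open>
  Bounds independent of \<open>j\<close> are needed because the powers \<open>q ^ j\<close> are summed over \<open>j\<close>.
  They hold because a number \<open>i\<close> has at most \<open>2 ^ i\<close> compositions into \<open>j\<close> positive parts.
\<close>

lemma norm_fps_power_nth_le:
  fixes q :: "complex fps"
  assumes q0: "q $ 0 = 0" and q: "\<And>i. i > 0 \<Longrightarrow> cmod (q $ i) \<le> a ^ i" and "a > 0"
  shows "cmod ((q ^ j) $ i) \<le> (2 * a) ^ i"
proof (induction j arbitrary: i)
  case 0 then show ?case using \<open>a > 0\<close> by (cases i) auto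
next
  case (Suc j)
  have "cmod ((q ^ Suc j) $ i) = cmod (\<Sum>l=0..i. q $ l * (q ^ j) $ (i - l))"
    by (simp add: fps_mult_nth)
  also have "\<dots> \<le> (\<Sum>l=0..i. cmod (q $ l) * cmod ((q ^ j) $ (i - l)))"
    by (intro sum_norm_le) (simp add: norm_mult)
  also have "\<dots> = (\<Sum>l=1..i. cmod (q $ l) * cmod ((q ^ j) $ (i - l)))"
    using q0 by (intro sum.mono_neutral_right) (auto simp: not_le)
  also have "\<dots> \<le> (\<Sum>l=1..i. a ^ l * (2 * a) ^ (i - l))"
    using \<open>a > 0\<close> by (intro sum_mono mult_mono Suc q) auto
  also have "\<dots> = (\<Sum>l=1..i. (2 * a) ^ i * (1/2) ^ l)"
  proof (intro sum.cong refl)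
    fix l assume "l \<in> {1..i}"
    then have "(2 * a) ^ i = (2 * a) ^ l * (2 * a) ^ (i - l)"
      by (metis atLeastAtMost_iff le_add_diff_inverse power_add)
    then show "a ^ l * (2 * a) ^ (i - l) = (2 * a) ^ i * (1/2) ^ l"
      by (simp add: power_mult_distrib power_divide)
  qed
  also have "\<dots> = (2 * a) ^ i * (\<Sum>l=1..i. (1/2) ^ l)" by (simp add: sum_distrib_left)
  also have "\<dots> \<le> (2 * a) ^ i * 1"
  proof (intro mult_left_mono)
    have "(\<Sum>l=1..i. (1/2::real) ^ l) = 1 - (1/2) ^ i" by (induction i) auto
    then show "(\<Sum>l=1..i. (1/2::real) ^ l) \<le> 1" by simp
  qed (use \<open>a > 0\<close> in auto)
  finally show ?case by simp
qed

lemma pcompose_eq_sum: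
  "pcompose p q = (\<Sum>i\<le>degree p. Polynomial.smult (coeff p i) (q ^ i))"
proof -
  have "pcompose (monom c i) q = Polynomial.smult c (q ^ i)" for c i
    by (induction i) (simp_all add: monom_0 monom_Suc pcompose_pCons)
  then show ?thesis
    using pcompose_sum[of "\<lambda>i. monom (coeff p i) i" "{..degree p}" q] by (simp add: poly_as_sum_of_monoms)
qed

lemma pcompose_power: "pcompose (p ^ k) q = pcompose p q ^ k"
  by (induction k) (simp_all add: pcompose_1 pcompose_mult)

context poly_seminorm
begin

text \<open>
  With \<open>Q = (1 + Y) ^ m - 1\<close> one has \<open>Y = (\<Sum>j\<ge>1. ((1 / m) gchoose j) * Q ^ j)\<close> as formal
  series in \<open>Y\<close>.  Cutting the sum off at \<open>J\<close> leaves a polynomial in \<open>Y\<close> that is divisible by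
  \<open>Y ^ J\<close> and whose coefficients grow at most geometrically, up to a factor \<open>J\<close>, at a rate
  independent of \<open>J\<close>; it tends to 0 as \<open>J\<close> grows because \<open>Y\<close> is quasinilpotent.  The remaining sum is at most \<open>2 / m\<close>, as the coefficients are at most \<open>1 / m\<close>.
\<close>

lemma quasinilpotent_le_of_power:
  assumes quasi: "\<And>s. s > 0 \<Longrightarrow> growth_le Y s" and m: "m > 0"
    and small: "\<nu> ((1 + Y) ^ m - 1) \<le> 1/2"
  shows "\<nu> Y \<le> 2 / real m"
proof -
  define c where "c j = ((1 / of_nat m :: complex) gchoose j)" for j
  define q where "q = [:1, 1:] ^ m - (1 :: complex poly)"
  define fq where "fq = (1 + fps_X) ^ m - (1 :: complex fps)"
  define Q where "Q = (1 + Y) ^ m - 1"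
  have fq: "fps_of_poly q = fq"
    by (simp add: q_def fq_def fps_of_poly_diff fps_of_poly_power fps_of_poly_linear')
  have fq0: "fq $ 0 = 0" by (simp add: fq_def fps_nth_power_0)
  define A where "A = (2 * 2 ^ m :: real)"
  have A: "A > 0" by (simp add: A_def)
  have fqA: "cmod ((fq ^ j) $ i) \<le> A ^ i" for i j
    unfolding A_def
  proof (rule norm_fps_power_nth_le[OF fq0])
    fix i :: nat assume i: "i > 0"
    have "fq $ i = of_nat (m choose i)"
      using i unfolding fq_def fps_binomial_of_nat[symmetric] by (simp add: binomial_gbinomial)
    also have "cmod \<dots> \<le> 2 ^ m"
      using of_nat_mono[OF binomial_le_pow2[of m i], where 'a = real] by simp
    also have "(2::real) ^ m \<le> (2 ^ m) ^ i" using i by (intro self_le_power) auto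
    finally show "cmod (fq $ i) \<le> (2 ^ m) ^ i" .
  qed simp
  obtain C where C: "\<And>k. \<nu> (Y ^ k) \<le> C * (1 / (2 * A)) ^ k"
    using quasi[of "1 / (2 * A)"] A unfolding growth_le_def by auto
  have C0: "C \<ge> 0" using C[of 0] nonneg[of "Y ^ 0"] by simp
  have main: "\<nu> Y \<le> 2 / real m + 4 * C * (real J * (1/2) ^ J)" if J: "J \<ge> 2" for J
  proof -
    \<comment> \<open>the formal error of the cut-off binomial series, as a polynomial in one variable\<close>
    define P where "P = [:0, 1:] - (\<Sum>j=1..<J. Polynomial.smult (c j) (q ^ j))"
    have coeffP: "coeff P i = fps_X $ i - (\<Sum>j=1..<J. c j * (fq ^ j) $ i)" for i
    proof -
      have "fps_of_poly P = fps_X - (\<Sum>j=1..<J. fps_const (c j) * fq ^ j)"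
        by (simp add: P_def fps_of_poly_diff fps_of_poly_sum fps_of_poly_smult fps_of_poly_power fq fps_of_poly_fps_X)
      then have "fps_of_poly P $ i = (fps_X - (\<Sum>j=1..<J. fps_const (c j) * fq ^ j)) $ i" by simp
      then show ?thesis by (simp add: fps_sum_nth)
    qed
    have low: "coeff P i = 0" if "i < J" for i
    proof (cases "i = 0")
      case True
      then show ?thesis unfolding coeffP using fq0 by (simp add: fps_nth_power_0)
    next
      case False
      have "(1 + fps_X :: complex fps) $ i = (\<Sum>j=0..i. c j * (fq ^ j) $ i)"
        using arg_cong[OF binomial_root_compose[OF m], of "\<lambda>f. f $ i"]
        by (simp add: fps_compose_nth c_def fq_def)
      also have "\<dots> = (\<Sum>j=1..<J. c j * (fq ^ j) $ i)"
      proof (rule sum.mono_neutral_cong)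
        fix j assume "j \<in> {1..<J} - {0..i}"
        then show "c j * (fq ^ j) $ i = 0" using startsby_zero_power_prefix[OF fq0, of j] by auto
      next
        fix j assume "j \<in> {0..i} - {1..<J}"
        then have "j = 0" using \<open>i < J\<close> by auto
        then show "c j * (fq ^ j) $ i = 0" using False by simp
      qed auto
      finally show ?thesis unfolding coeffP using False by simp
    qed
    have high: "cmod (coeff P i) \<le> real J * A ^ i" if "i \<ge> J" for i
    proof -
      have "coeff P i = - (\<Sum>j=1..<J. c j * (fq ^ j) $ i)" unfolding coeffP using that J by (simp add: fps_X_def)
      then have "cmod (coeff P i) \<le> (\<Sum>j=1..<J. cmod (c j) * cmod ((fq ^ j) $ i))"
        by (simp add: sum_norm_le norm_mult)
      also have "\<dots> \<le> (\<Sum>j=1..<J. 1 * A ^ i)"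
      proof (intro sum_mono mult_mono fqA)
        fix j assume "j \<in> {1..<J}"
        then obtain l where "j = Suc l" by (cases j) auto
        then show "cmod (c j) \<le> 1" unfolding c_def
          using norm_binomial_root_coeff_le[OF m, of l] m by (smt (verit, best) divide_le_eq_1 of_nat_0_less_iff of_nat_1 of_nat_mono Suc_leI One_nat_def)
      qed auto
      also have "\<dots> \<le> real J * A ^ i" using A by (simp add: mult_right_mono)
      finally show ?thesis .
    qed
    have "pcompose q Y = Q"
      by (simp add: q_def Q_def pcompose_diff pcompose_power pcompose_pCons pcompose_1 one_pCons[symmetric])
    then have "pcompose P Y = Y - (\<Sum>j=1..<J. Polynomial.smult (c j) (Q ^ j))"
      by (simp add: P_def pcompose_diff pcompose_sum pcompose_smult pcompose_power pcompose_pCons)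
    then have "Y = (\<Sum>j=1..<J. Polynomial.smult (c j) (Q ^ j)) + pcompose P Y" by simp
    then have "\<nu> Y \<le> \<nu> (\<Sum>j=1..<J. Polynomial.smult (c j) (Q ^ j)) + \<nu> (pcompose P Y)"
      using add_le by metis
    also have "\<nu> (\<Sum>j=1..<J. Polynomial.smult (c j) (Q ^ j)) \<le> (\<Sum>j=1..<J. 2 / real m * (1/2) ^ j)"
    proof (rule order_trans[OF sum_le], rule sum_mono)
      fix j assume "j \<in> {1..<J}"
      then obtain l where l: "j = Suc l" by (cases j) auto
      have "\<nu> (Polynomial.smult (c j) (Q ^ j)) \<le> 2 * cmod (c j) * \<nu> (Q ^ j)" by (rule smult_le)
      also have "\<dots> \<le> 2 * (1 / real m) * (1/2) ^ j"
      proof (intro mult_mono mult_left_mono nonneg)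
        show "cmod (c j) \<le> 1 / real m" unfolding c_def l by (rule norm_binomial_root_coeff_le[OF m])
        have "\<nu> (Q ^ j) \<le> \<nu> Q ^ j" unfolding l by (rule power_Suc_le)
        also have "\<dots> \<le> (1/2) ^ j" using small nonneg unfolding Q_def by (intro power_mono) auto
        finally show "\<nu> (Q ^ j) \<le> (1/2) ^ j" .
      qed auto
      finally show "\<nu> (Polynomial.smult (c j) (Q ^ j)) \<le> 2 / real m * (1/2) ^ j" by simp
    qed
    also have "(\<Sum>j=1..<J. 2 / real m * (1/2) ^ j) \<le> 2 / real m"
    proof -
      have "(\<Sum>j=1..<J. (1/2::real) ^ j) \<le> 1"
      proof -
        have "(\<Sum>j=1..l. (1/2::real) ^ j) = 1 - (1/2) ^ l" for l by (induction l) auto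
        moreover have "{1..<J} = {1..J - 1}" using J by auto
        ultimately show ?thesis by simp
      qed
      then have "2 / real m * (\<Sum>j=1..<J. (1/2::real) ^ j) \<le> 2 / real m * 1"
        by (intro mult_left_mono) auto
      then show ?thesis by (simp add: sum_distrib_left)
    qed
    also have "\<nu> (pcompose P Y) \<le> 4 * C * (real J * (1/2) ^ J)"
    proof -
      have "\<nu> (pcompose P Y) \<le> (\<Sum>i\<le>degree P. \<nu> (Polynomial.smult (coeff P i) (Y ^ i)))"
        unfolding pcompose_eq_sum by (rule sum_le)
      also have "\<dots> \<le> (\<Sum>i\<le>degree P. if i < J then 0 else 2 * real J * C * (1/2) ^ i)"
      proof (rule sum_mono)
        fix i
        show "\<nu> (Polynomial.smult (coeff P i) (Y ^ i)) \<le> (if i < J then 0 else 2 * real J * C * (1/2) ^ i)"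
        proof (cases "i < J")
          case False
          have "\<nu> (Polynomial.smult (coeff P i) (Y ^ i)) \<le> 2 * cmod (coeff P i) * \<nu> (Y ^ i)" by (rule smult_le)
          also have "\<dots> \<le> 2 * (real J * A ^ i) * (C * (1 / (2 * A)) ^ i)"
            using False high[of i] C[of i] A nonneg by (intro mult_mono mult_left_mono) auto
          also have "\<dots> = 2 * real J * C * (1/2) ^ i" using A by (simp add: power_divide power_mult_distrib)
          finally show ?thesis using False by simp
        qed (simp add: low)
      qed
      also have "\<dots> \<le> (\<Sum>i=J..<J + Suc (degree P). 2 * real J * C * (1/2) ^ i)"
      proof -
        have "(\<Sum>i\<le>degree P. if i < J then 0 else 2 * real J * C * (1/2) ^ i)
            = (\<Sum>i\<in>{J..degree P}. 2 * real J * C * (1/2) ^ i)"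
          by (rule sum.mono_neutral_cong_right) auto
        also have "\<dots> \<le> (\<Sum>i=J..<J + Suc (degree P). 2 * real J * C * (1/2) ^ i)"
          by (rule sum_mono2) (use C0 in auto)
        finally show ?thesis .
      qed
      also have "\<dots> = 2 * real J * C * (1/2) ^ J * (\<Sum>i<Suc (degree P). (1/2) ^ i)"
        unfolding sum_distrib_left
        using sum.shift_bounds_nat_ivl[of "\<lambda>i. 2 * real J * C * (1/2) ^ i" 0 J "Suc (degree P)"]
        by (simp only: atLeast0LessThan add_0_left add.commute[of J] power_add mult_ac)
      also have "\<dots> \<le> 2 * real J * C * (1/2) ^ J * 2"
      proof (intro mult_left_mono)
        show "(\<Sum>i<Suc (degree P). (1/2::real) ^ i) \<le> 2" by (simp only: geometric_sum) simp
      qed (use C0 in auto)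
      finally show ?thesis by (simp add: mult_ac)
    qed
    finally show ?thesis by simp
  qed
  have "(\<lambda>J. 2 / real m + 4 * C * (real J * (1/2) ^ J)) \<longlonglongrightarrow> 2 / real m + 4 * C * 0"
    using powser_times_n_limit_0[of "1/2 :: real"] by (intro tendsto_intros) simp
  moreover have "\<forall>\<^sub>F J in sequentially. \<nu> Y \<le> 2 / real m + 4 * C * (real J * (1/2) ^ J)"
    using eventually_ge_at_top[of 2] by eventually_elim (rule main)
  ultimately show ?thesis
    using tendsto_lowerbound[of _ _ sequentially "\<nu> Y"] by fastforce
qed

end

section \<open>The circle condition and units of Banach algebras\<close>

definition circle_nss :: "(nat \<Rightarrow> nat) \<Rightarrow> bool" where
  "circle_nss n \<longleftrightarrow>
     (\<exists>\<epsilon>>0. \<forall>z. cmod z = 1 \<longrightarrow> (\<forall>k. cmod (z ^ n k - 1) < \<epsilon>) \<longrightarrow> z = 1)"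

text \<open>
  Off the circle the powers \<open>z ^ n k\<close> tend to 0 or to infinity, so they leave
  every small neighbourhood of 1.
\<close>

lemma circle_nss_plane:
  assumes "strict_mono n" "circle_nss n"
  obtains \<epsilon> where "0 < \<epsilon>" "\<epsilon> \<le> 1" "\<And>z. z \<noteq> 1 \<Longrightarrow> \<exists>k. \<epsilon> \<le> cmod (z ^ n k - 1)"
proof -
  obtain e where e: "e > 0" "\<And>z. cmod z = 1 \<Longrightarrow> (\<forall>k. cmod (z ^ n k - 1) < e) \<Longrightarrow> z = 1"
    using assms(2) unfolding circle_nss_def by blast
  have lim: "filterlim n at_top sequentially" using assms(1) by (rule filterlim_subseq)
  show thesis
  proof (rule that[of "min e (1/2)"])
    fix z :: complex assume z: "z \<noteq> 1"
    consider "cmod z = 1" | "cmod z < 1" | "cmod z > 1" by linarith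
    then show "\<exists>k. min e (1/2) \<le> cmod (z ^ n k - 1)"
    proof cases
      case 1
      then obtain k where "\<not> cmod (z ^ n k - 1) < e" using e(2)[of z] z by blast
      then show ?thesis by (intro exI[of _ k]) auto
    next
      case 2
      have "(\<lambda>k. cmod z ^ n k) \<longlonglongrightarrow> 0"
        by (rule filterlim_compose[OF LIMSEQ_realpow_zero lim]) (use 2 in auto)
      then have "\<forall>\<^sub>F k in sequentially. cmod z ^ n k < 1/2" by (rule order_tendstoD) simp
      then obtain k where "cmod z ^ n k < 1/2" by (meson eventually_happens' sequentially_bot)
      then show ?thesis using norm_triangle_ineq2[of 1 "z ^ n k"]
        by (intro exI[of _ k]) (simp add: norm_power norm_minus_commute)
    next
      case 3
      have "filterlim (\<lambda>k. z ^ n k) at_infinity sequentially"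
        by (rule filterlim_compose[OF filterlim_realpow_sequentially_gt1 lim]) (use 3 in auto)
      then have "filterlim (\<lambda>k. cmod z ^ n k) at_top sequentially"
        using filterlim_at_infinity_imp_norm_at_top by (fastforce simp: norm_power)
      then have "\<forall>\<^sub>F k in sequentially. cmod z ^ n k > 2" by (rule filterlim_at_top_dense[THEN iffD1, rule_format])
      then obtain k where "cmod z ^ n k > 2" by (meson eventually_happens' sequentially_bot)
      then show ?thesis using norm_triangle_ineq2[of "z ^ n k" 1]
        by (intro exI[of _ k]) (simp add: norm_power)
    qed
  qed (use e in auto)
qed

text \<open>
  Here \<open>[:0, 1:]\<close> stands for the group element.  For \<open>w \<noteq> 1\<close> choose \<open>k\<close> with \<open>w ^ n k\<close> far
  from 1.  Then \<open>X ^ n k - w ^ n k\<close> is close to the nonzero constant \<open>1 - w ^ n k\<close>, hence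
  approximately invertible, and so is its divisor \<open>X - w\<close>.  So \<open>X - 1\<close> is quasinilpotent.
\<close>

lemma (in poly_seminorm) unit_rigidity:
  fixes n :: "nat \<Rightarrow> nat"
  assumes n: "strict_mono n"
    and \<epsilon>: "0 < \<epsilon>" "\<epsilon> \<le> 1" "\<And>z. z \<noteq> 1 \<Longrightarrow> \<exists>k. \<epsilon> \<le> cmod (z ^ n k - 1)"
    and small: "\<And>k. \<nu> ([:0, 1:] ^ n k - 1) \<le> \<epsilon> / 8"
  shows "\<nu> ([:0, 1:] - 1) = 0"
proof -
  define Y :: "complex poly" where "Y = [:0, 1:] - 1"
  have quasi: "growth_le Y s" if "s > 0" for s
  proof (rule quasinilpotent[OF _ that])
    fix u :: complex assume u: "u \<noteq> 0"
    \<comment> \<open>1 - u * Y is a multiple of X - w\<close>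
    define w where "w = 1 + inverse u"
    have "w \<noteq> 1" using u by (simp add: w_def)
    then obtain k where k: "\<epsilon> \<le> cmod (w ^ n k - 1)" using \<epsilon>(3) by blast
    define c where "c = 1 - w ^ n k"
    have c: "cmod c \<ge> \<epsilon>" "c \<noteq> 0" using k \<epsilon> by (auto simp: c_def norm_minus_commute)
    obtain P where P: "[:0, 1:] ^ n k - [:w:] ^ n k = ([:0, 1:] - [:w:]) * P"
      using power_diff_sumr2 by blast
    define p where "p = Polynomial.smult (- inverse u / c) P"
    have "1 - Polynomial.smult u Y = Polynomial.smult (- u) ([:0, 1:] - [:w:])"
      using u by (simp add: Y_def w_def one_pCons algebra_simps)
    then have "(1 - Polynomial.smult u Y) * p
        = Polynomial.smult (- inverse u / c * - u) (([:0, 1:] - [:w:]) * P)"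
      by (simp only: p_def mult_smult_left mult_smult_right smult_smult)
    also have "\<dots> = Polynomial.smult (1 / c) ([:0, 1:] ^ n k - [:w:] ^ n k)"
      using u by (simp only: P) simp
    also have "[:w:] ^ n k = 1 - [:c:]" by (simp add: c_def poly_const_pow one_pCons)
    also have "[:0, 1:] ^ n k - (1 - [:c:]) = ([:0, 1:] ^ n k - 1) + [:c:]" by simp
    also have "Polynomial.smult (1 / c) \<dots> = Polynomial.smult (1 / c) ([:0, 1:] ^ n k - 1) + 1"
      using c by (simp only: smult_add_right) (simp add: one_pCons)
    finally have "1 - (1 - Polynomial.smult u Y) * p = Polynomial.smult (- (1 / c)) ([:0, 1:] ^ n k - 1)"
      by (simp only: smult_minus_left) (simp only: diff_add_eq_diff_diff_swap diff_self diff_0)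
    then have "\<nu> (1 - (1 - Polynomial.smult u Y) * p) \<le> 2 * cmod (- (1 / c)) * \<nu> ([:0, 1:] ^ n k - 1)"
      by (simp only: smult_le)
    also have "\<dots> \<le> 2 * (1 / \<epsilon>) * (\<epsilon> / 8)"
      using c \<epsilon> small nonneg by (intro mult_mono) (auto simp: norm_divide frac_le)
    also have "\<dots> = 1/4" using \<epsilon> by simp
    finally show "\<exists>p. \<nu> (1 - (1 - Polynomial.smult u Y) * p) \<le> 1/4" by blast
  qed
  have lim: "filterlim n at_top sequentially" using n by (rule filterlim_subseq)
  have "\<nu> Y \<le> 2 / real (n (Suc k))" for k
  proof (rule quasinilpotent_le_of_power[OF quasi])
    show "n (Suc k) > 0" using strict_monoD[OF n, of k "Suc k"] by simp
    show "\<nu> ((1 + Y) ^ n (Suc k) - 1) \<le> 1/2" using small[of "Suc k"] \<epsilon> by (simp add: Y_def)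
  qed
  moreover have "(\<lambda>k. 2 / real (n (Suc k))) \<longlonglongrightarrow> 0"
    by (intro tendsto_divide_0[OF tendsto_const] filterlim_at_top_imp_at_infinity
          filterlim_compose[OF filterlim_real_sequentially] filterlim_compose[OF lim] filterlim_Suc)
  ultimately have "\<nu> Y \<le> 0" by (intro LIMSEQ_le_const) auto
  then show ?thesis using nonneg[of Y] by (simp add: Y_def)
qed

lemma (in normed_space) N_diff_commute:
  assumes "x \<in> carrier E" "y \<in> carrier E"
  shows "N (x \<ominus> y) = N (y \<ominus> x)"
  using Metric_space.commute[OF Metric_space_norm_dist, of x y] assms by (simp add: norm_dist_def)

context unital_banach_algebra
begin

definition poly_at :: "'a \<Rightarrow> 'k poly \<Rightarrow> 'a" where
  "poly_at a p = fold_coeffs (\<lambda>c x. c \<odot> \<one> \<oplus> a \<otimes> x) p \<zero>"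

lemma smult_in_carrier [simp]: "x \<in> carrier A \<Longrightarrow> c \<odot> x \<in> carrier A"
  by (rule smult_closed) (simp_all add: ring_of_type_algebra_def)

lemma smult_add_scalar: "x \<in> carrier A \<Longrightarrow> (c + d) \<odot> x = c \<odot> x \<oplus> d \<odot> x"
  using smult_l_distr[of c d x] by (simp add: ring_of_type_algebra_def)

lemma smult_add_vector:
  "\<lbrakk>x \<in> carrier A; y \<in> carrier A\<rbrakk> \<Longrightarrow> c \<odot> (x \<oplus> y) = c \<odot> x \<oplus> c \<odot> y"
  using smult_r_distr[of c x y] by (simp add: ring_of_type_algebra_def)

lemma smult_mult_scalar: "x \<in> carrier A \<Longrightarrow> (c * d) \<odot> x = c \<odot> (d \<odot> x)"
  using smult_assoc1[of c d x] by (simp add: ring_of_type_algebra_def)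

lemma smult_scalar_one [simp]: "x \<in> carrier A \<Longrightarrow> 1 \<odot> x = x"
  using smult_one[of x] by (simp add: ring_of_type_algebra_def)

lemma smult_scalar_zero [simp]: "x \<in> carrier A \<Longrightarrow> 0 \<odot> x = \<zero>"
  using smult_l_null[of x] by (simp add: ring_of_type_algebra_def)

lemma smult_vector_zero [simp]: "c \<odot> \<zero> = \<zero>"
  using smult_mult_scalar[of "\<zero>" c 0] by simp

context
  fixes a assumes a: "a \<in> carrier A"
begin

lemma poly_at_0 [simp]: "poly_at a 0 = \<zero>"
  by (simp add: poly_at_def)

lemma poly_at_pCons [simp]: "poly_at a (pCons c p) = c \<odot> \<one> \<oplus> a \<otimes> poly_at a p"
  using a by (cases "p = 0 \<and> c = 0") (auto simp: poly_at_def fold_coeffs_pCons_not_0_0_eq)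

lemma poly_at_closed [simp]: "poly_at a p \<in> carrier A"
  using a by (induction p) auto

lemma poly_at_add: "poly_at a (p + q) = poly_at a p \<oplus> poly_at a q"
proof (induction p q rule: poly_induct2)
  case (pCons c p d q)
  then show ?case using a by (simp add: smult_add_scalar r_distr a_ac)
qed simp

lemma poly_at_smult: "poly_at a (Polynomial.smult c p) = c \<odot> poly_at a p"
  using a by (induction p) (simp_all add: smult_add_vector smult_mult_scalar smult_mult_right)

lemma poly_at_mult: "poly_at a (p * q) = poly_at a p \<otimes> poly_at a q"
  using a by (induction p)
    (simp_all add: poly_at_add poly_at_smult l_distr smult_mult_left m_assoc)

lemma poly_at_1: "poly_at a 1 = \<one>"
  using a by (simp add: one_pCons)

lemma poly_at_power: "poly_at a (p ^ k) = poly_at a p [^] k"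
proof (induction k)
  case (Suc k)
  then show ?case by (simp only: power_Suc2 poly_at_mult nat_pow_Suc)
qed (simp add: poly_at_1)

lemma poly_at_diff: "poly_at a (p - q) = poly_at a p \<ominus> poly_at a q"
proof -
  have "poly_at a p = poly_at a (p - q) \<oplus> poly_at a q"
    by (simp flip: poly_at_add)
  then show ?thesis by (simp add: a_minus_def a_assoc r_neg)
qed

lemma poly_at_var: "poly_at a [:0, 1:] = a"
  using a by simp

lemma poly_at_var_power_minus_1: "poly_at a ([:0, 1:] ^ k - 1) = a [^] k \<ominus> \<one>"
  by (simp only: poly_at_diff poly_at_power poly_at_var poly_at_1)

lemma N_poly_at_const: "N (poly_at a [:c:]) = norm c"
  using a by (simp add: N_smult N_one)

lemma N_poly_at_add_le: "N (poly_at a (p + q)) \<le> N (poly_at a p) + N (poly_at a q)"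
  by (simp add: poly_at_add N_triangle)

lemma N_poly_at_diff_le: "N (poly_at a (p - q)) \<le> N (poly_at a p) + N (poly_at a q)"
proof -
  have "p - q = p + Polynomial.smult (- 1) q" by simp
  then have "N (poly_at a (p - q)) \<le> N (poly_at a p) + N (poly_at a (Polynomial.smult (- 1) q))"
    by (metis N_poly_at_add_le)
  then show ?thesis by (simp only: poly_at_smult N_smult poly_at_closed) simp
qed

lemma N_poly_at_mult_le: "N (poly_at a (p * q)) \<le> N (poly_at a p) * N (poly_at a q)"
  by (simp add: poly_at_mult N_mult)

lemma eq_one_if_N_diff: "N (a \<ominus> \<one>) = 0 \<Longrightarrow> a = \<one>"
  using a N_eq_0_iff[of "a \<ominus> \<one>"] by simp

end

end

lemma complex_algebra_rigidity:
  assumes A: "unital_banach_algebra (A :: (complex, 'a) module) N"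
    and n: "strict_mono n" "circle_nss n"
  obtains \<delta> where "\<delta> > 0"
    "\<And>a. \<lbrakk>a \<in> carrier A; \<forall>k. N (a [^]\<^bsub>A\<^esub> n k \<ominus>\<^bsub>A\<^esub> \<one>\<^bsub>A\<^esub>) < \<delta>\<rbrakk> \<Longrightarrow> a = \<one>\<^bsub>A\<^esub>"
proof -
  interpret unital_banach_algebra A N by (rule A)
  obtain \<epsilon> where \<epsilon>: "0 < \<epsilon>" "\<epsilon> \<le> 1" "\<And>z. z \<noteq> 1 \<Longrightarrow> \<exists>k. \<epsilon> \<le> cmod (z ^ n k - 1)"
    using circle_nss_plane[OF n] by blast
  show thesis
  proof (rule that[of "\<epsilon> / 8"])
    fix a assume a: "a \<in> carrier A" and small: "\<forall>k. N (a [^]\<^bsub>A\<^esub> n k \<ominus>\<^bsub>A\<^esub> \<one>\<^bsub>A\<^esub>) < \<epsilon> / 8"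
    interpret poly_seminorm "\<lambda>p. N (poly_at a p)"
    proof
      fix p q :: "complex poly" and c :: complex
      show "0 \<le> N (poly_at a p)" by (rule N_nonneg) (rule poly_at_closed[OF a])
      show "N (poly_at a (p + q)) \<le> N (poly_at a p) + N (poly_at a q)" by (rule N_poly_at_add_le[OF a])
      show "N (poly_at a (p * q)) \<le> N (poly_at a p) * N (poly_at a q)" by (rule N_poly_at_mult_le[OF a])
      show "N (poly_at a [:c:]) \<le> 2 * cmod c" by (simp only: N_poly_at_const[OF a]) simp
    qed
    have "N (poly_at a ([:0, 1:] - 1)) = 0"
      by (rule unit_rigidity[OF n(1) \<epsilon>])
        (use small in \<open>simp_all add: poly_at_var_power_minus_1[OF a] less_imp_le\<close>)
    then show "a = \<one>\<^bsub>A\<^esub>"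
      using eq_one_if_N_diff[OF a] by (simp only: poly_at_diff[OF a] poly_at_var[OF a] poly_at_1[OF a])
  qed (use \<epsilon> in simp)
qed

lemma map_poly_Re_Im_mult:
  "map_poly Re (p * q) = map_poly Re p * map_poly Re q - map_poly Im p * map_poly Im q"
  "map_poly Im (p * q) = map_poly Re p * map_poly Im q + map_poly Im p * map_poly Re q"
  by (rule poly_eqI; simp add: coeff_map_poly coeff_mult sum_subtractf sum.distrib)+

lemma map_poly_Re_Im_add:
  "map_poly Re (p + q) = map_poly Re p + map_poly Re q"
  "map_poly Im (p + q) = map_poly Im p + map_poly Im q"
  by (rule poly_eqI; simp add: coeff_map_poly)+

lemma map_poly_Re_Im_var_power:
  "map_poly Re ([:0, 1:] ^ k) = [:0, 1:] ^ k" "map_poly Im ([:0, 1:] ^ k) = 0"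
  by (induction k) (simp_all add: map_poly_pCons one_pCons)

lemma map_poly_Re_Im_var_power_minus_1:
  "map_poly Re ([:0, 1:] ^ k - 1) = [:0, 1:] ^ k - 1" "map_poly Im ([:0, 1:] ^ k - 1) = 0"
proof -
  have "map_poly Re (p - 1) = map_poly Re p - 1" "map_poly Im (p - 1) = map_poly Im p" for p
    by (rule poly_eqI; simp add: coeff_map_poly coeff_1)+
  then show "map_poly Re ([:0, 1:] ^ k - 1) = [:0, 1:] ^ k - 1" "map_poly Im ([:0, 1:] ^ k - 1) = 0"
    by (simp_all only: map_poly_Re_Im_var_power)
qed

text \<open>
  Splitting a polynomial into real and imaginary part plays the role of complexification.
  On \<open>[:0, 1:] ^ k - 1\<close>, which has real coefficients, the seminorm agrees with the norm of \<open>A\<close>.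
\<close>

lemma real_algebra_rigidity:
  assumes A: "unital_banach_algebra (A :: (real, 'a) module) N"
    and n: "strict_mono n" "circle_nss n"
  obtains \<delta> where "\<delta> > 0"
    "\<And>a. \<lbrakk>a \<in> carrier A; \<forall>k. N (a [^]\<^bsub>A\<^esub> n k \<ominus>\<^bsub>A\<^esub> \<one>\<^bsub>A\<^esub>) < \<delta>\<rbrakk> \<Longrightarrow> a = \<one>\<^bsub>A\<^esub>"
proof -
  interpret unital_banach_algebra A N by (rule A)
  obtain \<epsilon> where \<epsilon>: "0 < \<epsilon>" "\<epsilon> \<le> 1" "\<And>z. z \<noteq> 1 \<Longrightarrow> \<exists>k. \<epsilon> \<le> cmod (z ^ n k - 1)"
    using circle_nss_plane[OF n] by blast
  show thesis
  proof (rule that[of "\<epsilon> / 8"])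
    fix a assume a: "a \<in> carrier A" and small: "\<forall>k. N (a [^]\<^bsub>A\<^esub> n k \<ominus>\<^bsub>A\<^esub> \<one>\<^bsub>A\<^esub>) < \<epsilon> / 8"
    define M where "M p = N (poly_at a p)" for p
    have M0: "0 \<le> M p" for p unfolding M_def by (rule N_nonneg) (rule poly_at_closed[OF a])
    have M_zero: "M 0 = 0" unfolding M_def using N_poly_at_const[OF a, of 0] by simp
    note M = N_poly_at_add_le[OF a, folded M_def] N_poly_at_diff_le[OF a, folded M_def]
      N_poly_at_mult_le[OF a, folded M_def]
    interpret poly_seminorm "\<lambda>p. M (map_poly Re p) + M (map_poly Im p)"
    proof
      fix p q :: "complex poly" and c :: complex
      show "0 \<le> M (map_poly Re p) + M (map_poly Im p)" using M0 by (simp add: add_nonneg_nonneg)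
      show "M (map_poly Re (p + q)) + M (map_poly Im (p + q))
        \<le> (M (map_poly Re p) + M (map_poly Im p)) + (M (map_poly Re q) + M (map_poly Im q))"
        using M(1)[of "map_poly Re p" "map_poly Re q"] M(1)[of "map_poly Im p" "map_poly Im q"]
        by (simp add: map_poly_Re_Im_add)
      have "M (map_poly Re (p * q))
        \<le> M (map_poly Re p) * M (map_poly Re q) + M (map_poly Im p) * M (map_poly Im q)"
        unfolding map_poly_Re_Im_mult by (rule order_trans[OF M(2)]) (intro add_mono M(3))
      moreover have "M (map_poly Im (p * q))
        \<le> M (map_poly Re p) * M (map_poly Im q) + M (map_poly Im p) * M (map_poly Re q)"
        unfolding map_poly_Re_Im_mult by (rule order_trans[OF M(1)]) (intro add_mono M(3))
      ultimately show "M (map_poly Re (p * q)) + M (map_poly Im (p * q))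
        \<le> (M (map_poly Re p) + M (map_poly Im p)) * (M (map_poly Re q) + M (map_poly Im q))"
        by (simp add: distrib_left distrib_right)
      have "map_poly Re [:c:] = [:Re c:]" "map_poly Im [:c:] = [:Im c:]"
        by (simp_all add: map_poly_pCons)
      moreover have "M [:x:] = \<bar>x\<bar>" for x :: real
        unfolding M_def N_poly_at_const[OF a] by simp
      ultimately show "M (map_poly Re [:c:]) + M (map_poly Im [:c:]) \<le> 2 * cmod c"
        using abs_Re_le_cmod[of c] abs_Im_le_cmod[of c] by simp
    qed
    have Mk: "M ([:0, 1:] ^ k - 1) = N (a [^]\<^bsub>A\<^esub> k \<ominus>\<^bsub>A\<^esub> \<one>\<^bsub>A\<^esub>)" for k
      unfolding M_def poly_at_var_power_minus_1[OF a] by simp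
    have "M (map_poly Re ([:0, 1:] - 1)) + M (map_poly Im ([:0, 1:] - 1)) = 0"
    proof (rule unit_rigidity[OF n(1) \<epsilon>(1,2)])
      fix k
      show "M (map_poly Re ([:0, 1:] ^ n k - 1)) + M (map_poly Im ([:0, 1:] ^ n k - 1)) \<le> \<epsilon> / 8"
        unfolding map_poly_Re_Im_var_power_minus_1 Mk M_zero using small by (simp add: less_imp_le)
    qed (rule \<epsilon>(3))
    then have "N (a \<ominus>\<^bsub>A\<^esub> \<one>\<^bsub>A\<^esub>) = 0"
      using map_poly_Re_Im_var_power_minus_1[of 1] Mk[of 1] a by (simp add: M_zero del: one_pCons)
    then show "a = \<one>\<^bsub>A\<^esub>" by (rule eq_one_if_N_diff[OF a])
  qed (use \<epsilon> in simp)
qed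

text \<open>
  The neighbourhood in the group is the preimage of a ball around the unit of the algebra.
\<close>

lemma nss_if_algebra_rigidity:
  fixes A :: "('k::real_normed_field, 'a) module"
  assumes G: "topological_group G \<tau>" and A: "unital_banach_algebra A N"
    and \<phi>: "\<phi> \<in> hom G (units_of A)" "inj_on \<phi> (carrier G)"
      "continuous_map \<tau> (subtopology (norm_topology A N) (Units A)) \<phi>"
    and \<delta>: "\<delta> > 0"
      "\<And>a. \<lbrakk>a \<in> carrier A; \<forall>k. N (a [^]\<^bsub>A\<^esub> n k \<ominus>\<^bsub>A\<^esub> \<one>\<^bsub>A\<^esub>) < \<delta>\<rbrakk> \<Longrightarrow> a = \<one>\<^bsub>A\<^esub>"
  shows "nss G \<tau> n"
proof -
  interpret G: topological_group G \<tau> by (rule G)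
  interpret A: unital_banach_algebra A N by (rule A)
  interpret M: Metric_space "carrier A" "norm_dist A N" by (rule A.Metric_space_norm_dist)
  have \<phi>_one: "\<phi> \<one>\<^bsub>G\<^esub> = \<one>\<^bsub>A\<^esub>"
    using hom_one[OF \<phi>(1) G.is_group A.units_group] by (simp add: units_of_one)
  have \<phi>_in: "\<phi> g \<in> carrier A" if "g \<in> carrier G" for g
    using \<phi>(1) that A.Units_closed by (auto simp: hom_def units_of_carrier)
  have \<phi>_pow: "\<phi> (g [^]\<^bsub>G\<^esub> (k::nat)) = \<phi> g [^]\<^bsub>A\<^esub> k" if "g \<in> carrier G" for g k
  proof (induction k)
    case (Suc k)
    then show ?case using \<phi>(1) that by (simp add: hom_def units_of_mult)
  qed (simp add: \<phi>_one)
  define V where "V = {g \<in> topspace \<tau>. \<phi> g \<in> M.mball \<one>\<^bsub>A\<^esub> \<delta>}"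
  have "openin \<tau> V"
    unfolding V_def
    by (rule openin_continuous_map_preimage[where Y = "norm_topology A N"])
       (use \<phi>(3) in \<open>simp_all add: continuous_map_in_subtopology norm_topology_def\<close>)
  moreover have "\<one>\<^bsub>G\<^esub> \<in> V"
    using \<delta>(1) by (simp add: V_def G.topspace_eq \<phi>_one)
  moreover have "V \<subseteq> carrier G" by (auto simp: V_def G.topspace_eq)
  moreover have "g = \<one>\<^bsub>G\<^esub>" if g: "g \<in> carrier G" "\<forall>k. g [^]\<^bsub>G\<^esub> n k \<in> V" for g
  proof -
    have "N (\<phi> g [^]\<^bsub>A\<^esub> n k \<ominus>\<^bsub>A\<^esub> \<one>\<^bsub>A\<^esub>) < \<delta>" for k
    proof -
      have "\<phi> (g [^]\<^bsub>G\<^esub> n k) \<in> M.mball \<one>\<^bsub>A\<^esub> \<delta>" using g(2) by (auto simp: V_def)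
      then have "\<phi> g [^]\<^bsub>A\<^esub> n k \<in> M.mball \<one>\<^bsub>A\<^esub> \<delta>" by (simp only: \<phi>_pow[OF g(1)])
      then show ?thesis
        using A.N_diff_commute[of "\<one>\<^bsub>A\<^esub>" "\<phi> g [^]\<^bsub>A\<^esub> n k"] by (auto simp: norm_dist_def)
    qed
    then have "\<phi> g = \<phi> \<one>\<^bsub>G\<^esub>" using \<delta>(2)[OF \<phi>_in[OF g(1)]] \<phi>_one by simp
    then show ?thesis using \<phi>(2) g(1) by (auto dest: inj_onD)
  qed
  ultimately show ?thesis unfolding nss_def by blast
qed

lemma circle_nss_imp_nss_for_linear_banach_lie_groups:
  assumes n: "strict_mono n" "circle_nss n"
  shows "nss_for_linear_banach_lie_groups TYPE('g) TYPE('a) n"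
  unfolding nss_for_linear_banach_lie_groups_def
proof (intro allI impI)
  fix G :: "'g monoid" and \<tau>
  assume "linear_banach_lie_group TYPE(real) TYPE('a) G \<tau> \<or> linear_banach_lie_group TYPE(complex) TYPE('a) G \<tau>"
  then show "nss G \<tau> n"
  proof
    assume "linear_banach_lie_group TYPE(real) TYPE('a) G \<tau>"
    then show ?thesis unfolding linear_banach_lie_group_def
      by (metis nss_if_algebra_rigidity real_algebra_rigidity[OF _ n])
  next
    assume "linear_banach_lie_group TYPE(complex) TYPE('a) G \<tau>"
    then show ?thesis unfolding linear_banach_lie_group_def
      by (metis nss_if_algebra_rigidity complex_algebra_rigidity[OF _ n])
  qed
qed

section \<open>Banach spaces on a prescribed type and the circle group\<close>

lemma ring_of_type_algebra_simps [simp]: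
  "carrier (ring_of_type_algebra :: 'k::ring_1 ring) = UNIV"
  "add (ring_of_type_algebra :: 'k ring) = (+)"
  "mult (ring_of_type_algebra :: 'k ring) = (*)"
  "one (ring_of_type_algebra :: 'k ring) = 1"
  "zero (ring_of_type_algebra :: 'k ring) = 0"
  by (simp_all add: ring_of_type_algebra_def)

text \<open>
  Structures with carrier in a given type \<open>'x\<close> are obtained by copying a complex Banach
  space \<open>S\<close> along an injection \<open>j\<close>.  The multiplication \<open>sc\<close> by complex scalars is a
  parameter because the type class of normed spaces provides real scalars only.
\<close>

locale complex_subspace =
  fixes S :: "'v::real_normed_vector set" and sc :: "complex \<Rightarrow> 'v \<Rightarrow> 'v" and j :: "'v \<Rightarrow> 'x"
  assumes inj: "inj j"
    and S_zero: "0 \<in> S"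
    and S_add: "\<lbrakk>x \<in> S; y \<in> S\<rbrakk> \<Longrightarrow> x + y \<in> S"
    and S_sc: "x \<in> S \<Longrightarrow> sc c x \<in> S"
    and S_complete: "complete S"
    and sc_add_right: "sc c (x + y) = sc c x + sc c y"
    and sc_add_left: "sc (c + d) x = sc c x + sc d x"
    and sc_sc: "sc (c * d) x = sc c (sc d x)"
    and sc_one: "sc 1 x = x"
    and norm_sc: "norm (sc c x) = cmod c * norm x"
begin

text \<open>
  The multiplication and the unit are parameters, so that one construction yields both the
  one-dimensional algebra and, with the zero multiplication, a Banach space of sequences.
\<close>

definition copy :: "('v \<Rightarrow> 'v \<Rightarrow> 'v) \<Rightarrow> 'v \<Rightarrow> (complex, 'x) module" where
  "copy mu e = \<lparr>carrier = j ` S, mult = (\<lambda>x y. j (mu (inv_into UNIV j x) (inv_into UNIV j y))), one = j e,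
     zero = j 0, add = (\<lambda>x y. j (inv_into UNIV j x + inv_into UNIV j y)), smult = (\<lambda>c x. j (sc c (inv_into UNIV j x)))\<rparr>"

definition copy_norm :: "'x \<Rightarrow> real" where
  "copy_norm x = norm (inv_into UNIV j x)"

lemma inv_j [simp]: "inv_into UNIV j (j x) = x"
  using inj by simp

lemma j_eq_iff [simp]: "j x = j y \<longleftrightarrow> x = y"
  using inj by (rule inj_eq)

lemma copy_simps [simp]:
  "carrier (copy mu e) = j ` S"
  "add (copy mu e) (j x) (j y) = j (x + y)"
  "mult (copy mu e) (j x) (j y) = j (mu x y)"
  "zero (copy mu e) = j 0"
  "one (copy mu e) = j e"
  "smult (copy mu e) c (j x) = j (sc c x)"
  by (simp_all add: copy_def)

lemma copy_norm_j [simp]: "copy_norm (j x) = norm x"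
  by (simp add: copy_norm_def)

lemma sc_zero: "sc 0 x = 0"
  using norm_sc[of 0 x] by simp

lemma S_uminus: "x \<in> S \<Longrightarrow> - x \<in> S"
proof -
  have "sc (- 1) x + x = 0" using sc_add_left[of "- 1" 1 x] by (simp add: sc_one sc_zero)
  then have "sc (- 1) x = - x" by (simp add: eq_neg_iff_add_eq_0)
  then show "x \<in> S \<Longrightarrow> - x \<in> S" using S_sc[of x "- 1"] by simp
qed

lemma abelian_group_copy: "abelian_group (copy mu e)"
proof (rule abelian_groupI)
  fix x assume "x \<in> carrier (copy mu e)"
  then obtain u where "x = j u" "u \<in> S" by auto
  then show "\<exists>y\<in>carrier (copy mu e). y \<oplus>\<^bsub>copy mu e\<^esub> x = \<zero>\<^bsub>copy mu e\<^esub>"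
    by (intro bexI[of _ "j (- u)"]) (auto simp: S_uminus)
qed (auto simp: S_zero S_add add_ac)

lemma minus_copy [simp]:
  assumes "x \<in> S" "y \<in> S"
  shows "j x \<ominus>\<^bsub>copy mu e\<^esub> j y = j (x - y)"
proof -
  interpret abelian_group "copy mu e" by (rule abelian_group_copy)
  have "j (- y) \<oplus>\<^bsub>copy mu e\<^esub> j y = \<zero>\<^bsub>copy mu e\<^esub>" by simp
  then have "\<ominus>\<^bsub>copy mu e\<^esub> j y = j (- y)"
    by (rule minus_equality) (use assms S_uminus in auto)
  then show ?thesis by (simp add: a_minus_def)
qed

lemma norm_dist_copy [simp]:
  assumes "x \<in> S" "y \<in> S"
  shows "norm_dist (copy mu e) copy_norm (j x) (j y) = dist x y"
  using assms by (simp add: norm_dist_def dist_norm)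

lemma normed_space_copy: "normed_space (copy mu e) copy_norm"
proof (intro normed_space.intro normed_space_axioms.intro)
  show "Module.module (ring_of_type_algebra :: complex ring) (copy mu e)"
    by (rule moduleI)
       (auto simp: cring_from_type_algebra abelian_group_copy S_sc sc_add_right sc_add_left sc_sc sc_one)
qed (auto simp: norm_sc norm_triangle_ineq)

lemma Metric_space_copy: "Metric_space (j ` S) (norm_dist (copy mu e) copy_norm)"
  using normed_space.Metric_space_norm_dist[OF normed_space_copy] by simp

lemma banach_space_copy: "banach_space (copy mu e) copy_norm"
proof (intro banach_space.intro banach_space_axioms.intro normed_space_copy)
  interpret M: Metric_space "j ` S" "norm_dist (copy mu e) copy_norm"
    by (rule Metric_space_copy)
  show "Metric_space.mcomplete (carrier (copy mu e)) (norm_dist (copy mu e) copy_norm)"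
    unfolding copy_simps M.mcomplete_def
  proof (intro allI impI)
    fix \<sigma> assume \<sigma>: "M.MCauchy \<sigma>"
    then have "\<forall>k. \<exists>u. u \<in> S \<and> \<sigma> k = j u" unfolding M.MCauchy_def by blast
    then obtain u where u: "\<And>k. u k \<in> S" "\<And>k. \<sigma> k = j (u k)" by metis
    have "Cauchy u"
      using \<sigma> unfolding M.MCauchy_def Cauchy_def by (simp add: u)
    then obtain l where l: "l \<in> S" "u \<longlonglongrightarrow> l"
      using S_complete u(1) unfolding complete_def by blast
    have "limitin M.mtopology \<sigma> (j l) sequentially"
      using l tendstoD[OF l(2)] by (auto simp: M.limitin_metric u elim!: eventually_mono)
    then show "\<exists>x. limitin M.mtopology \<sigma> x sequentially" by blast
  qed
qed

lemma continuous_map_copy: "continuous_map (top_of_set S) (norm_topology (copy mu e) copy_norm) j"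
proof -
  interpret M: Metric_space "j ` S" "norm_dist (copy mu e) copy_norm"
    by (rule Metric_space_copy)
  show ?thesis
    unfolding norm_topology_def copy_simps M.continuous_map_to_metric
  proof (intro ballI allI impI)
    fix x and r :: real assume "x \<in> topspace (top_of_set S)" "r > 0"
    then show "\<exists>U. openin (top_of_set S) U \<and> x \<in> U \<and> (\<forall>y\<in>U. j y \<in> M.mball (j x) r)"
      by (intro exI[of _ "S \<inter> ball x r"]) (auto simp: openin_open_Int)
  qed
qed

lemma separable_space_copy:
  assumes "countable D" "D \<subseteq> S" "S \<subseteq> closure D"
  shows "separable_space (norm_topology (copy mu e) copy_norm)"
proof -
  have "separable_space (top_of_set S)"
    unfolding separable_space_def using assms by (auto intro!: exI[of _ D] simp: closure_of_subtopology Int_absorb1)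
  moreover have "topspace (norm_topology (copy mu e) copy_norm) = j ` S"
    using Metric_space.topspace_mtopology[OF Metric_space_copy[of mu e]]
    by (simp add: norm_topology_def)
  ultimately show ?thesis
    using separable_space_continuous_map_image[OF _ continuous_map_copy[of mu e]] by simp
qed

end

lemma complex_subspace_complex: "inj (j :: complex \<Rightarrow> 'x) \<Longrightarrow> complex_subspace UNIV (*) j"
  by unfold_locales (auto simp: algebra_simps norm_mult complete_UNIV)

lemma unital_banach_algebra_complex_copy:
  assumes "inj (j :: complex \<Rightarrow> 'x)"
  shows "unital_banach_algebra (complex_subspace.copy UNIV (*) j (*) 1) (complex_subspace.copy_norm j)"
proof -
  interpret complex_subspace UNIV "(*)" j by (rule complex_subspace_complex[OF assms])
  show ?thesis
  proof (intro unital_banach_algebra.intro unital_banach_algebra_axioms.intro banach_space_copy)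
    show "ring (copy (*) 1)"
      by (intro ringI abelian_group_copy monoidI) (auto simp: algebra_simps)
  qed (auto simp: norm_mult)
qed

lemma continuous_map_into_pullback:
  assumes "continuous_map S T (\<lambda>x. i (f x))" "f ` topspace S \<subseteq> C"
  shows "continuous_map S (pullback_topology C i T) f"
  by (rule continuous_map_pullback') (use assms in \<open>auto simp: comp_def\<close>)

lemma linear_banach_lie_group_circle_copy:
  fixes h :: "complex \<Rightarrow> 'g" and j :: "complex \<Rightarrow> 'x"
  assumes h: "inj h" and j: "inj j"
  defines "G \<equiv> \<lparr>carrier = h ` sphere 0 1, mult = (\<lambda>x y. h (inv_into UNIV h x * inv_into UNIV h y)), one = h 1\<rparr>"
  shows "linear_banach_lie_group TYPE(complex) TYPE('x) G (pullback_topology (h ` sphere 0 1) (inv_into UNIV h) euclidean)"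
proof -
  interpret A: complex_subspace UNIV "(*)" j by (rule complex_subspace_complex[OF j])
  interpret A: unital_banach_algebra "A.copy (*) 1" A.copy_norm
    by (rule unital_banach_algebra_complex_copy[OF j])
  define \<tau> where "\<tau> = pullback_topology (h ` sphere 0 1) (inv_into UNIV h) (euclidean :: complex topology)"
  have ih [simp]: "inv_into UNIV h (h z) = z" for z using h by simp
  have hh [simp]: "h z = h w \<longleftrightarrow> z = w" for z w using h by (rule inj_eq)
  have G_simps [simp]: "carrier G = h ` sphere 0 1" "\<one>\<^bsub>G\<^esub> = h 1" "h z \<otimes>\<^bsub>G\<^esub> h w = h (z * w)" for z w
    by (simp_all add: G_def)
  have grp: "group G"
  proof (rule groupI)
    fix x assume "x \<in> carrier G"
    then obtain z where "x = h z" "cmod z = 1" by auto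
    moreover from this have "z \<noteq> 0" by auto
    ultimately show "\<exists>y\<in>carrier G. y \<otimes>\<^bsub>G\<^esub> x = \<one>\<^bsub>G\<^esub>"
      by (intro bexI[of _ "h (inverse z)"]) (auto simp: norm_inverse)
  qed (auto simp: norm_mult mult_ac)
  then interpret G: group G .
  have inv_h: "inv\<^bsub>G\<^esub> (h z) = h (inverse z)" if "cmod z = 1" for z
  proof (rule G.inv_equality)
    have "z \<noteq> 0" using that by auto
    then show "h (inverse z) \<otimes>\<^bsub>G\<^esub> h z = \<one>\<^bsub>G\<^esub>" by simp
  qed (use that in \<open>auto simp: norm_inverse\<close>)
  have top: "topspace \<tau> = h ` sphere 0 1"
    by (auto simp: \<tau>_def topspace_pullback_topology)
  have cont_inv: "continuous_map \<tau> euclidean (inv_into UNIV h)"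
    using continuous_map_pullback[OF continuous_map_id, of "h ` sphere 0 1" "inv_into UNIV h" euclidean]
    by (simp add: \<tau>_def)
  have "topological_group G \<tau>"
  proof (intro topological_group.intro topological_group_axioms.intro grp)
    show "continuous_map (prod_topology \<tau> \<tau>) \<tau> (\<lambda>(x, y). x \<otimes>\<^bsub>G\<^esub> y)"
    proof (unfold \<tau>_def, rule continuous_map_into_pullback, fold \<tau>_def)
      have "continuous_map (prod_topology \<tau> \<tau>) euclidean (\<lambda>p. inv_into UNIV h (fst p) * inv_into UNIV h (snd p))"
        using continuous_map_compose[OF continuous_map_fst cont_inv, of \<tau>]
          continuous_map_compose[OF continuous_map_snd cont_inv, of \<tau>]
        by (simp add: continuous_map_atin comp_def tendsto_mult)
      then show "continuous_map (prod_topology \<tau> \<tau>) euclidean (\<lambda>x. inv_into UNIV h (case x of (x, y) \<Rightarrow> x \<otimes>\<^bsub>G\<^esub> y))"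
        by (simp add: o_def case_prod_unfold G_def)
    qed (auto simp: top norm_mult)
    show "continuous_map \<tau> \<tau> (\<lambda>x. inv\<^bsub>G\<^esub> x)"
    proof (unfold \<tau>_def, rule continuous_map_into_pullback, fold \<tau>_def)
      have "continuous_map \<tau> euclidean (\<lambda>x. inverse (inv_into UNIV h x))"
      proof -
        have "inv_into UNIV h x \<noteq> 0" if "x \<in> topspace \<tau>" for x using that by (auto simp: top)
        then show ?thesis using cont_inv by (simp add: continuous_map_atin tendsto_inverse)
      qed
      then show "continuous_map \<tau> euclidean (\<lambda>x. inv_into UNIV h (inv\<^bsub>G\<^esub> x))"
        by (rule continuous_map_eq) (auto simp: top inv_h)
    qed (auto simp: top inv_h norm_inverse)
  qed (simp add: top)
  moreover have "(\<lambda>x. j (inv_into UNIV h x)) \<in> hom G (units_of (A.copy (*) 1))"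
  proof (rule homI)
    fix x assume "x \<in> carrier G"
    then obtain z where z: "x = h z" "cmod z = 1" by auto
    then have "z \<noteq> 0" by auto
    then show "j (inv_into UNIV h x) \<in> carrier (units_of (A.copy (*) 1))"
      unfolding units_of_carrier Units_def using z by (auto intro!: exI[of _ "inverse z"])
  qed (auto simp: units_of_mult)
  moreover have "inj_on (\<lambda>x. j (inv_into UNIV h x)) (carrier G)"
    by (rule inj_onI) auto
  moreover have "continuous_map \<tau> (subtopology (norm_topology (A.copy (*) 1) A.copy_norm) (Units (A.copy (*) 1)))
     (\<lambda>x. j (inv_into UNIV h x))"
    unfolding continuous_map_in_subtopology
  proof (intro conjI)
    show "continuous_map \<tau> (norm_topology (A.copy (*) 1) A.copy_norm) (\<lambda>x. j (inv_into UNIV h x))"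
      using continuous_map_compose[OF cont_inv A.continuous_map_copy[simplified], of "(*)" 1]
      by (simp add: o_def)
    show "(\<lambda>x. j (inv_into UNIV h x)) \<in> topspace \<tau> \<rightarrow> Units (A.copy (*) 1)"
    proof
      fix x assume "x \<in> topspace \<tau>"
      then obtain z where z: "x = h z" "cmod z = 1" by (auto simp: top)
      then have "z \<noteq> 0" by auto
      then show "j (inv_into UNIV h x) \<in> Units (A.copy (*) 1)"
        unfolding Units_def using z by (auto intro!: exI[of _ "inverse z"])
    qed
  qed
  ultimately show ?thesis
    unfolding linear_banach_lie_group_def \<tau>_def[symmetric]
    using A.unital_banach_algebra_axioms by blast
qed

text \<open>
  The neighbourhood that witnesses the NSS property of the copied circle contains an arc around 1,
  which provides the radius \<open>\<epsilon>\<close>.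
\<close>

lemma nss_circle_copy:
  fixes h :: "complex \<Rightarrow> 'g"
  assumes h: "inj h"
    and nss: "nss \<lparr>carrier = h ` sphere 0 1, mult = (\<lambda>x y. h (inv_into UNIV h x * inv_into UNIV h y)), one = h 1\<rparr>
      (pullback_topology (h ` sphere 0 1) (inv_into UNIV h) euclidean) n"
  shows "\<exists>\<epsilon>>0. \<forall>z. cmod z = 1 \<longrightarrow> (\<forall>k. cmod (z ^ n k - 1) < \<epsilon>) \<longrightarrow> z = 1"
proof -
  define G where "G = \<lparr>carrier = h ` sphere 0 1, mult = (\<lambda>x y. h (inv_into UNIV h x * inv_into UNIV h y)), one = h 1\<rparr>"
  have ih [simp]: "inv_into UNIV h (h z) = z" for z using h by simp
  have hh [simp]: "h z = h w \<longleftrightarrow> z = w" for z w using h by (rule inj_eq)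
  obtain U V where UV: "openin (pullback_topology (h ` sphere 0 1) (inv_into UNIV h) euclidean) V" "h 1 \<in> V" "V \<subseteq> U"
    and U: "\<And>g. \<lbrakk>g \<in> carrier G; \<forall>k. g [^]\<^bsub>G\<^esub> n k \<in> U\<rbrakk> \<Longrightarrow> g = h 1"
  proof -
    have "\<one>\<^bsub>G\<^esub> = h 1" by (simp add: G_def)
    then show thesis using nss that unfolding nss_def G_def[symmetric] by metis
  qed
  obtain W where W: "open W" "V = inv_into UNIV h -` W \<inter> h ` sphere 0 1"
    using UV(1) unfolding openin_pullback_topology by auto
  obtain \<epsilon> where \<epsilon>: "\<epsilon> > 0" "ball 1 \<epsilon> \<subseteq> W"
    using W UV(2) by (auto simp: open_contains_ball)
  have pow: "h z [^]\<^bsub>G\<^esub> (k::nat) = h (z ^ k)" for z k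
    by (induction k) (simp_all add: G_def nat_pow_def mult.commute)
  show ?thesis
  proof (intro exI[of _ \<epsilon>] conjI allI impI \<epsilon>)
    fix z assume z: "cmod z = 1" "\<forall>k. cmod (z ^ n k - 1) < \<epsilon>"
    have "h z [^]\<^bsub>G\<^esub> n k \<in> U" for k
    proof -
      have "z ^ n k \<in> W" using z \<epsilon> by (auto simp: dist_norm norm_minus_commute)
      then have "h (z ^ n k) \<in> V" using z by (simp add: W norm_power)
      then show ?thesis using UV(3) by (auto simp: pow)
    qed
    then have "h z = h 1" using z by (intro U) (auto simp: G_def)
    then show "z = 1" by simp
  qed
qed

section \<open>Separation of unit eigenvectors\<close>

lemma (in normed_space) smult_diff:
  assumes "x \<in> carrier E" "y \<in> carrier E"
  shows "c \<odot> (x \<ominus> y) = c \<odot> x \<ominus> c \<odot> y"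
  using assms smult_r_distr[of c x "\<ominus> y"] smult_r_minus[of c y] by (simp add: a_minus_def)

lemma (in normed_space) smult_scalar_diff:
  assumes "x \<in> carrier E"
  shows "(c - d) \<odot> x = c \<odot> x \<ominus> d \<odot> x"
proof -
  have "c \<odot> x = (c - d) \<odot> x \<oplus> d \<odot> x"
    using smult_l_distr[of "c - d" d x] assms by simp
  then show ?thesis using assms by (simp add: a_minus_def a_assoc r_neg)
qed

locale bounded_operator = normed_space E N
  for E :: "('k::real_normed_field, 'a) module" (structure) and N +
  fixes T
  assumes T: "bounded_linear_operator E N T"
begin

lemma funpow_closed: "x \<in> carrier E \<Longrightarrow> (T ^^ m) x \<in> carrier E"
  using T by (induction m) (auto simp: bounded_linear_operator_def)

lemma funpow_diff:
  assumes "x \<in> carrier E" "y \<in> carrier E"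
  shows "(T ^^ m) (x \<ominus> y) = (T ^^ m) x \<ominus> (T ^^ m) y"
proof (induction m)
  case (Suc m)
  have diff: "T (u \<ominus> v) = T u \<ominus> T v" if "u \<in> carrier E" "v \<in> carrier E" for u v
  proof -
    have cl: "T u \<in> carrier E" "T v \<in> carrier E" "T (u \<ominus> v) \<in> carrier E"
      using T that by (auto simp: bounded_linear_operator_def)
    have "u = (u \<ominus> v) \<oplus> v" using that by (simp add: a_minus_def a_assoc l_neg)
    then have "T u = T (u \<ominus> v) \<oplus> T v"
      using T that unfolding bounded_linear_operator_def by (metis minus_closed)
    then show ?thesis using cl by (simp add: a_minus_def a_assoc r_neg)
  qed
  show ?case using diff Suc funpow_closed assms by simp
qed simp

lemma funpow_eigenvector:
  assumes "x \<in> carrier E" "T x = c \<odot> x"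
  shows "(T ^^ m) x = c ^ m \<odot> x"
proof (induction m)
  case 0 then show ?case using assms smult_one[of x] by simp
next
  case (Suc m)
  have "T (c ^ m \<odot> x) = c ^ m \<odot> (c \<odot> x)"
    using T assms by (simp add: bounded_linear_operator_def)
  also have "\<dots> = c ^ Suc m \<odot> x"
    using smult_assoc1[of "c ^ m" c x] assms(1) by (simp add: mult.commute)
  finally show ?case using Suc by simp
qed

lemma N_funpow_le:
  assumes "x \<in> carrier E"
  shows "N ((T ^^ m) x) \<le> operator_norm E N (T ^^ m) * N x"
proof -
  obtain C where C: "\<And>x. x \<in> carrier E \<Longrightarrow> N (T x) \<le> C * N x"
    using T unfolding bounded_linear_operator_def by blast
  define D where "D = max C 0"
  have D: "N (T x) \<le> D * N x" if "x \<in> carrier E" for x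
    using C[OF that] mult_right_mono[of C D "N x"] N_nonneg[OF that] by (simp add: D_def)
  have D0: "D \<ge> 0" by (simp add: D_def)
  have bound: "N ((T ^^ m) x) \<le> D ^ m * N x" if "x \<in> carrier E" for x
  proof (induction m)
    case (Suc m)
    have "N ((T ^^ Suc m) x) \<le> D * N ((T ^^ m) x)" using D funpow_closed that by simp
    also have "\<dots> \<le> D * (D ^ m * N x)" by (intro mult_left_mono Suc D0)
    finally show ?case by simp
  qed simp
  have "bdd_above ((\<lambda>x. N ((T ^^ m) x) / N x) ` carrier E)"
  proof (rule bdd_aboveI2)
    fix x assume x: "x \<in> carrier E"
    show "N ((T ^^ m) x) / N x \<le> D ^ m"
      using bound[OF x] N_nonneg[OF x] D0 by (cases "N x = 0") (auto simp: divide_le_eq)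
  qed
  then have "N ((T ^^ m) x) / N x \<le> operator_norm E N (T ^^ m)"
    unfolding operator_norm_def using assms by (intro cSUP_upper)
  then show ?thesis
    using bound[OF assms] N_nonneg[OF assms] by (cases "N x = 0") (auto simp: divide_le_eq)
qed

lemma unit_eigenvector:
  assumes "c \<in> eigenvalues E T"
  obtains x where "x \<in> carrier E" "N x = 1" "T x = c \<odot> x"
proof -
  obtain x where x: "x \<in> carrier E" "x \<noteq> \<zero>" "T x = c \<odot> x"
    using assms unfolding eigenvalues_def by blast
  have N: "N x > 0" using x N_nonneg[of x] N_eq_0_iff[of x] by (simp add: less_le)
  define a where "a = (of_real (inverse (N x)) :: 'k)"
  show thesis
  proof (rule that[of "a \<odot> x"])
    show "a \<odot> x \<in> carrier E" using x by simp
    show "N (a \<odot> x) = 1" using x N by (simp add: N_smult a_def norm_inverse)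
    have "T (a \<odot> x) = a \<odot> (c \<odot> x)" using T x by (simp add: bounded_linear_operator_def)
    then show "T (a \<odot> x) = c \<odot> (a \<odot> x)"
      using smult_assoc1[of a c x] smult_assoc1[of c a x] x by (simp add: mult.commute)
  qed
qed

text \<open>
  The triangle inequality for \<open>c ^ m \<odot> x\<close>, \<open>d ^ m \<odot> y\<close> and \<open>d ^ m \<odot> x\<close>: the first two
  differ by \<open>(T ^^ m) (x \<ominus> y)\<close> and the last two by a unimodular multiple of \<open>x \<ominus> y\<close>.
\<close>

lemma unit_eigenvectors_apart:
  assumes x: "x \<in> carrier E" "N x = 1" "T x = c \<odot> x"
    and y: "y \<in> carrier E" "T y = d \<odot> y" "norm d = 1"
  shows "norm (c ^ m - d ^ m) \<le> (operator_norm E N (T ^^ m) + 1) * N (x \<ominus> y)"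
proof -
  interpret Metric_space "carrier E" "norm_dist E N" by (rule Metric_space_norm_dist)
  have cl: "c ^ m \<odot> x \<in> carrier E" "d ^ m \<odot> x \<in> carrier E" "d ^ m \<odot> y \<in> carrier E"
    using x y by simp_all
  have "norm (c ^ m - d ^ m) = N ((c ^ m - d ^ m) \<odot> x)" using x by (simp add: N_smult)
  also have "\<dots> = norm_dist E N (c ^ m \<odot> x) (d ^ m \<odot> x)"
    using x cl by (simp add: smult_scalar_diff norm_dist_def)
  also have "\<dots> \<le> norm_dist E N (c ^ m \<odot> x) (d ^ m \<odot> y) + norm_dist E N (d ^ m \<odot> x) (d ^ m \<odot> y)"
    by (rule triangle'[OF cl(1,3,2)])
  also have "norm_dist E N (c ^ m \<odot> x) (d ^ m \<odot> y) = N ((T ^^ m) (x \<ominus> y))"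
    using x y cl by (simp add: norm_dist_def funpow_diff funpow_eigenvector)
  also have "\<dots> \<le> operator_norm E N (T ^^ m) * N (x \<ominus> y)"
    using x y by (intro N_funpow_le) simp
  also have "norm_dist E N (d ^ m \<odot> x) (d ^ m \<odot> y) = N (x \<ominus> y)"
    using x y cl smult_diff[of x y "d ^ m", symmetric] by (simp add: norm_dist_def N_smult norm_power)
  finally show ?thesis by (simp add: distrib_right)
qed

end

lemma (in Metric_space) countable_if_uniformly_discrete:
  assumes "separable_space mtopology" "f ` I \<subseteq> M" "r > 0"
    and apart: "\<And>i j. \<lbrakk>i \<in> I; j \<in> I; i \<noteq> j\<rbrakk> \<Longrightarrow> r \<le> d (f i) (f j)"
  shows "countable I"
proof -
  obtain D where D: "countable D" "D \<subseteq> M" "mtopology closure_of D = M"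
    using assms(1) unfolding separable_space_def by auto
  have "\<exists>y\<in>D. y \<in> mball (f i) (r / 2)" if "i \<in> I" for i
  proof -
    have "f i \<in> mtopology closure_of D" using D(3) assms(2) that by auto
    then have "\<forall>s>0. \<exists>y\<in>D. y \<in> mball (f i) s" by (simp add: metric_closure_of)
    moreover have "r / 2 > 0" using assms(3) by simp
    ultimately show ?thesis by blast
  qed
  then obtain g where g: "\<And>i. i \<in> I \<Longrightarrow> g i \<in> D" "\<And>i. i \<in> I \<Longrightarrow> g i \<in> mball (f i) (r / 2)"
    by metis
  have "inj_on g I"
  proof (rule inj_onI, rule ccontr)
    fix i j assume ij: "i \<in> I" "j \<in> I" "g i = g j" "i \<noteq> j"
    have "d (f i) (f j) \<le> d (f i) (g i) + d (f j) (g i)"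
      using g(2)[OF ij(1)] g(2)[OF ij(2)] ij by (intro triangle') auto
    also have "\<dots> < r" using g(2)[OF ij(1)] g(2)[OF ij(2)] ij(3) by auto
    finally show False using apart[OF ij(1,2,4)] by simp
  qed
  moreover have "countable (g ` I)" using g(1) D(1) countable_subset by (metis image_subsetI)
  ultimately show ?thesis by (rule countable_image_inj_on[rotated])
qed

lemma circle_nss_imp_jamison_sequence:
  assumes "circle_nss n"
  shows "jamison_sequence TYPE('b) n"
  unfolding jamison_sequence_def
proof (intro allI impI, elim conjE)
  fix E :: "(complex, 'b) module" and N T
  assume E: "banach_space E N" and sep: "separable_space (norm_topology E N)"
    and T: "bounded_linear_operator E N T"
    and bdd: "bdd_above (range (\<lambda>k. operator_norm E N (T ^^ n k)))"
  interpret banach_space E N by (rule E)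
  interpret bounded_operator E N T by unfold_locales (rule T)
  interpret Metric_space "carrier E" "norm_dist E N" by (rule Metric_space_norm_dist)
  define \<Lambda> where "\<Lambda> = {c \<in> eigenvalues E T. cmod c = 1}"
  obtain \<epsilon> where \<epsilon>: "\<epsilon> > 0" "\<And>z. cmod z = 1 \<Longrightarrow> (\<forall>k. cmod (z ^ n k - 1) < \<epsilon>) \<Longrightarrow> z = 1"
    using assms unfolding circle_nss_def by blast
  obtain M0 where M0: "\<And>k. operator_norm E N (T ^^ n k) \<le> M0"
    using bdd unfolding bdd_above_def by auto
  define M where "M = max M0 0 + 1"
  have M: "M > 0" "\<And>k. operator_norm E N (T ^^ n k) + 1 \<le> M"
    using M0 by (auto simp: M_def max_def intro: order_trans)
  have "\<forall>c\<in>\<Lambda>. \<exists>x. x \<in> carrier E \<and> N x = 1 \<and> T x = c \<odot>\<^bsub>E\<^esub> x"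
    using unit_eigenvector unfolding \<Lambda>_def by blast
  then obtain e where e: "\<And>c. c \<in> \<Lambda> \<Longrightarrow> e c \<in> carrier E" "\<And>c. c \<in> \<Lambda> \<Longrightarrow> N (e c) = 1"
    "\<And>c. c \<in> \<Lambda> \<Longrightarrow> T (e c) = c \<odot>\<^bsub>E\<^esub> e c"
    by metis
  have "countable \<Lambda>"
  proof (rule countable_if_uniformly_discrete)
    show "separable_space mtopology" using sep by (simp add: norm_topology_def)
    show "e ` \<Lambda> \<subseteq> carrier E" using e by auto
    show "\<epsilon> / M > 0" using \<epsilon> M by simp
    fix c d assume cd: "c \<in> \<Lambda>" "d \<in> \<Lambda>" "c \<noteq> d"
    have n1: "cmod c = 1" "cmod d = 1" using cd by (auto simp: \<Lambda>_def)
    then have d0: "d \<noteq> 0" by auto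
    then have "cmod (c / d) = 1" "c / d \<noteq> 1" using n1 cd by (auto simp: norm_divide)
    then obtain k where k: "\<epsilon> \<le> cmod ((c / d) ^ n k - 1)" using \<epsilon>(2)[of "c / d"] not_less by blast
    have "c ^ n k - d ^ n k = d ^ n k * ((c / d) ^ n k - 1)"
      using d0 by (simp add: power_divide algebra_simps)
    then have "\<epsilon> \<le> cmod (c ^ n k - d ^ n k)" using k n1 by (simp add: norm_mult norm_power)
    also have "\<dots> \<le> (operator_norm E N (T ^^ n k) + 1) * N (e c \<ominus>\<^bsub>E\<^esub> e d)"
      using cd e n1 by (intro unit_eigenvectors_apart) auto
    also have "\<dots> \<le> M * N (e c \<ominus>\<^bsub>E\<^esub> e d)"
      using cd e M by (intro mult_right_mono N_nonneg) auto
    finally show "\<epsilon> / M \<le> norm_dist E N (e c) (e d)"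
      using M cd e by (simp add: norm_dist_def divide_le_eq mult.commute)
  qed
  then show "countable {c \<in> eigenvalues E T. cmod c = 1}" by (simp add: \<Lambda>_def)
qed

section \<open>A weighted shift with uncountably many unimodular eigenvalues\<close>

text \<open>
  A uniformly Cauchy sequence of bounded continuous functions has a bounded continuous uniform
  limit, whatever the domain; below the domain is the discrete space \<^typ>\<open>nat\<close>.
\<close>

lemma complete_UNIV_bcontfun: "complete (UNIV :: ('s::topological_space \<Rightarrow>\<^sub>C 't::complete_space) set)"
proof (rule completeI)
  fix f :: "nat \<Rightarrow> 's \<Rightarrow>\<^sub>C 't" assume "Cauchy f"
  then have "uniformly_Cauchy_on UNIV (\<lambda>i. apply_bcontfun (f i))"
    unfolding uniformly_Cauchy_on_def Cauchy_def by (meson UNIV_I dist_fun_lt_imp_dist_val_lt)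
  then obtain l where "uniform_limit UNIV (\<lambda>i. apply_bcontfun (f i)) l sequentially"
    using Cauchy_uniformly_convergent uniformly_convergent_on_def by blast
  then obtain l' where "f \<longlonglongrightarrow> l'"
    by (rule uniform_limit_bcontfunE) auto
  then show "\<exists>l\<in>UNIV. f \<longlonglongrightarrow> l" by blast
qed

type_synonym cseq = "nat \<Rightarrow>\<^sub>C complex"

lemma apply_Bcontfun_nat:
  fixes f :: "nat \<Rightarrow> complex"
  assumes "\<And>m. cmod (f m) \<le> b"
  shows "apply_bcontfun (Bcontfun f) = f"
  by (rule Bcontfun_inverse, rule bcontfun_normI[OF Topological_Spaces.continuous_on_discrete]) (rule assms)

definition cscale :: "complex \<Rightarrow> cseq \<Rightarrow> cseq" where
  "cscale c y = Bcontfun (\<lambda>m. c * y m)"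

lemma cscale_apply [simp]: "apply_bcontfun (cscale c y) m = c * y m"
proof -
  have "cmod (c * y m) \<le> cmod c * norm y" for m
    by (simp add: norm_mult mult_left_mono norm_bounded)
  then show ?thesis unfolding cscale_def by (subst apply_Bcontfun_nat) auto
qed

lemma norm_cscale_le: "norm (cscale c y) \<le> cmod c * norm y"
  by (rule norm_bound) (simp add: norm_mult mult_left_mono norm_bounded)

lemma norm_cscale: "norm (cscale c y) = cmod c * norm y"
proof (cases "c = 0")
  case True then show ?thesis using norm_cscale_le[of c y] by simp
next
  case False
  have "norm y = norm (cscale (inverse c) (cscale c y))"
    using False by (intro arg_cong[where f = norm] bcontfun_eqI) simp
  also have "\<dots> \<le> cmod (inverse c) * norm (cscale c y)" by (rule norm_cscale_le)
  finally have "cmod c * norm y \<le> norm (cscale c y)" using False by (simp add: norm_inverse norm_divide field_simps)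
  then show ?thesis using norm_cscale_le[of c y] by simp
qed

lemma bounded_linear_cscale_right: "bounded_linear (cscale c)"
proof (rule bounded_linear_intro[where K = "cmod c"])
  show "cscale c (x + y) = cscale c x + cscale c y" for x y
    by (rule bcontfun_eqI) (simp add: distrib_left)
  show "cscale c (r *\<^sub>R x) = r *\<^sub>R cscale c x" for r x
    by (rule bcontfun_eqI) simp
qed (simp add: norm_cscale)

lemma bounded_linear_cscale_left: "bounded_linear (\<lambda>c. cscale c y)"
proof (rule bounded_linear_intro[where K = "norm y"])
  show "cscale (c + d) y = cscale c y + cscale d y" for c d
    by (rule bcontfun_eqI) (simp add: distrib_right)
  show "cscale (r *\<^sub>R c) y = r *\<^sub>R cscale c y" for r c
    by (rule bcontfun_eqI) simp
qed (simp add: norm_cscale)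

locale unit_first_sequence =
  fixes n :: "nat \<Rightarrow> nat"
  assumes n_0: "n 0 = 1"
begin

text \<open>
  A representation always exists because 1 is a member of the sequence.
\<close>

definition num_terms :: "nat \<Rightarrow> nat" where
  "num_terms m = (LEAST l. \<exists>ks :: nat list. length ks = l \<and> sum_list (map n ks) = m)"

lemma num_terms_witness: "\<exists>ks :: nat list. length ks = num_terms m \<and> sum_list (map n ks) = m"
  unfolding num_terms_def
proof (rule LeastI_ex)
  have "length (replicate m (0::nat)) = m \<and> sum_list (map n (replicate m 0)) = m"
    by (simp add: n_0 sum_list_replicate)
  then show "\<exists>l (ks :: nat list). length ks = l \<and> sum_list (map n ks) = m" by blast
qed

lemma num_terms_le: "sum_list (map n ks) = m \<Longrightarrow> num_terms m \<le> length ks"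
  unfolding num_terms_def by (rule Least_le) auto

lemma num_terms_add_le: "num_terms (m + n k) \<le> Suc (num_terms m)"
proof -
  obtain ks where "length ks = num_terms m" "sum_list (map n ks) = m" using num_terms_witness by blast
  then show ?thesis using num_terms_le[of "k # ks" "m + n k"] by simp
qed

definition weight :: "nat \<Rightarrow> real" where
  "weight m = (1/2) ^ num_terms m"

lemma weight_pos [simp]: "weight m > 0" by (simp add: weight_def)

lemma weight_nz [simp]: "weight m \<noteq> 0" by (simp add: weight_def)

lemma abs_weight [simp]: "\<bar>weight m\<bar> = weight m" by (simp add: weight_def)

lemma weight_le_1: "weight m \<le> 1" by (simp add: weight_def power_le_one)

lemma weight_add: "weight m / weight (m + n k) \<le> 2"
proof -
  have "(1/2::real) ^ Suc (num_terms m) \<le> (1/2) ^ num_terms (m + n k)"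
    by (rule power_decreasing[OF num_terms_add_le]) auto
  then have "weight m \<le> 2 * weight (m + n k)" by (simp add: weight_def)
  then show ?thesis by (simp add: divide_le_eq)
qed

text \<open>
  A sequence \<open>x\<close> in the weighted supremum norm is stored as the bounded function
  \<open>m \<mapsto> weight m * x m\<close>.  In these coordinates the left shift acquires the quotient of weights.
\<close>

definition shift :: "cseq \<Rightarrow> cseq" where
  "shift y = Bcontfun (\<lambda>m. of_real (weight m / weight (Suc m)) * y (Suc m))"

lemma shift_apply: "apply_bcontfun (shift y) m = of_real (weight m / weight (Suc m)) * y (Suc m)"
proof -
  have "cmod (of_real (weight m / weight (Suc m)) * y (Suc m)) \<le> 2 * norm y" for m
    unfolding norm_mult norm_of_real
    using weight_add[of m 0] by (intro mult_mono norm_bounded) (simp_all add: n_0)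
  then show ?thesis unfolding shift_def by (subst apply_Bcontfun_nat) auto
qed

lemma funpow_shift_apply: "apply_bcontfun ((shift ^^ k) y) m = of_real (weight m / weight (m + k)) * y (m + k)"
proof (induction k arbitrary: m)
  case (Suc k)
  then show ?case by (simp add: shift_apply flip: of_real_mult)
qed simp

lemma norm_funpow_shift_le: "norm ((shift ^^ n k) y) \<le> 2 * norm y"
proof (rule norm_bound)
  fix m
  show "cmod (apply_bcontfun ((shift ^^ n k) y) m) \<le> 2 * norm y"
    unfolding funpow_shift_apply norm_mult norm_of_real
    using weight_add[of m k] by (intro mult_mono norm_bounded) simp_all
qed

lemma bounded_linear_shift: "bounded_linear shift"
proof (rule bounded_linear_intro[where K = 2])
  fix x y :: cseq and r :: real
  show "shift (x + y) = shift x + shift y"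
    by (rule bcontfun_eqI) (simp only: shift_apply plus_bcontfun.rep_eq distrib_left)
  show "shift (r *\<^sub>R x) = r *\<^sub>R shift x"
    by (rule bcontfun_eqI) (simp add: shift_apply)
  show "norm (shift x) \<le> norm x * 2"
    using norm_funpow_shift_le[of 0 x] by (simp add: n_0 mult.commute)
qed

lemma shift_cscale: "shift (cscale c y) = cscale c (shift y)"
  by (rule bcontfun_eqI) (simp add: shift_apply)

text \<open>
  In these coordinates, this is the geometric sequence of \<open>z\<close>, an eigenvector of the shift.
\<close>

definition character :: "complex \<Rightarrow> cseq" where
  "character z = Bcontfun (\<lambda>m. of_real (weight m) * z ^ m)"

lemma character_apply: "cmod z = 1 \<Longrightarrow> apply_bcontfun (character z) m = of_real (weight m) * z ^ m"
  unfolding character_def by (subst apply_Bcontfun_nat[where b = 1]) (auto simp: norm_mult norm_power weight_le_1)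

lemma character_nonzero: "cmod z = 1 \<Longrightarrow> character z \<noteq> 0"
  using character_apply[of z 0] by auto

lemma shift_character: "cmod z = 1 \<Longrightarrow> shift (character z) = cscale z (character z)"
  by (rule bcontfun_eqI) (simp add: shift_apply character_apply)

text \<open>
  The distance of two orbits is the supremum of \<open>cmod (z ^ n k - w ^ n k)\<close> over \<open>k\<close>.
\<close>

definition orbit :: "complex \<Rightarrow> cseq" where
  "orbit z = Bcontfun (\<lambda>k. z ^ n k)"

lemma orbit_apply: "cmod z = 1 \<Longrightarrow> apply_bcontfun (orbit z) k = z ^ n k"
  unfolding orbit_def by (subst apply_Bcontfun_nat[where b = 1]) (auto simp: norm_power)

lemma cmod_power_diff_le_dist_orbit:
  assumes "cmod z = 1" "cmod w = 1"
  shows "cmod (z ^ sum_list (map n ks) - w ^ sum_list (map n ks)) \<le> real (length ks) * dist (orbit z) (orbit w)"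
proof (induction ks)
  case (Cons k ks)
  let ?s = "sum_list (map n ks)"
  have "z ^ (n k + ?s) - w ^ (n k + ?s) = z ^ n k * (z ^ ?s - w ^ ?s) + (z ^ n k - w ^ n k) * w ^ ?s"
    by (simp add: power_add algebra_simps)
  then have "cmod (z ^ (n k + ?s) - w ^ (n k + ?s))
     \<le> cmod (z ^ n k * (z ^ ?s - w ^ ?s)) + cmod ((z ^ n k - w ^ n k) * w ^ ?s)"
    by (metis norm_triangle_ineq)
  also have "\<dots> = cmod (z ^ ?s - w ^ ?s) + cmod (z ^ n k - w ^ n k)"
    using assms by (simp add: norm_mult norm_power)
  also have "cmod (z ^ n k - w ^ n k) \<le> dist (orbit z) (orbit w)"
    using dist_bounded[of "orbit z" k "orbit w"] assms by (simp add: orbit_apply dist_norm)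
  finally show ?case using Cons by (simp add: algebra_simps)
qed simp

text \<open>
  A power whose exponent is a sum of \<open>l\<close> terms changes by at most \<open>l\<close> times the distance of
  the orbits, and the weight \<open>2 ^ (- l)\<close> compensates the factor \<open>l\<close>.
\<close>

lemma dist_character_le_dist_orbit:
  assumes "cmod z = 1" "cmod w = 1"
  shows "dist (character z) (character w) \<le> dist (orbit z) (orbit w)"
proof (rule dist_bound)
  fix m
  obtain ks where ks: "length ks = num_terms m" "sum_list (map n ks) = m" using num_terms_witness by blast
  have "dist (character z m) (character w m) = weight m * cmod (z ^ m - w ^ m)"
    using assms by (simp add: character_apply dist_norm norm_mult flip: right_diff_distrib)
  also have "\<dots> \<le> weight m * (real (num_terms m) * dist (orbit z) (orbit w))"
    using cmod_power_diff_le_dist_orbit[OF assms, of ks] ks by (intro mult_left_mono) (auto simp: less_imp_le)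
  also have "weight m * (real (num_terms m) * dist (orbit z) (orbit w)) \<le> 1 * dist (orbit z) (orbit w)"
  proof -
    have "weight m * real (num_terms m) \<le> 1"
      using of_nat_less_two_power[of "num_terms m", where 'a = real] by (simp add: weight_def power_divide)
    then have "weight m * real (num_terms m) * dist (orbit z) (orbit w) \<le> 1 * dist (orbit z) (orbit w)"
      by (intro mult_right_mono) auto
    then show ?thesis by (simp add: mult.assoc)
  qed
  finally show "dist (character z m) (character w m) \<le> dist (orbit z) (orbit w)" by simp
qed

text \<open>
  Limits of orbits are again orbits, because the value at \<open>0\<close> of the orbit of \<open>z\<close> is \<open>z ^ 1\<close>.
\<close>

lemma limit_of_orbits:
  assumes C: "C \<subseteq> sphere 0 1" and p: "p \<in> closure (orbit ` C)"
  obtains z where "z = p 0" "cmod z = 1" "p = orbit z" "character z \<in> closure (character ` C)"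
proof -
  obtain x where x: "\<And>i. x i \<in> orbit ` C" "x \<longlonglongrightarrow> p"
    using p unfolding closure_sequential by blast
  then have "\<forall>i. \<exists>c. c \<in> C \<and> x i = orbit c" by blast
  then obtain c where c: "\<And>i. c i \<in> C" "\<And>i. x i = orbit (c i)" by metis
  have c1: "cmod (c i) = 1" for i using subsetD[OF C c(1)[of i]] by simp
  have lim: "(\<lambda>i. c i ^ n k) \<longlonglongrightarrow> p k" for k
  proof -
    have "(\<lambda>i. dist (c i ^ n k) (p k)) \<longlonglongrightarrow> 0"
    proof (rule Lim_null_comparison)
      show "(\<lambda>i. dist (x i) p) \<longlonglongrightarrow> 0" by (rule tendsto_dist_iff[THEN iffD1, OF x(2)])
      show "\<forall>\<^sub>F i in sequentially. norm (dist (c i ^ n k) (p k)) \<le> dist (x i) p"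
      proof (intro always_eventually allI)
        fix i
        show "norm (dist (c i ^ n k) (p k)) \<le> dist (x i) p"
          using dist_bounded[of "x i" k p] by (simp add: c(2) orbit_apply[OF c1])
      qed
    qed
    then show ?thesis by (rule tendsto_dist_iff[THEN iffD2])
  qed
  define z where "z = p 0"
  have z: "c \<longlonglongrightarrow> z" using lim[of 0] by (simp add: n_0 z_def)
  have "(\<lambda>i. cmod (c i)) \<longlonglongrightarrow> cmod z" by (intro tendsto_norm z)
  then have z1: "cmod z = 1" by (simp add: c1 LIMSEQ_const_iff)
  have "p k = z ^ n k" for k
    by (rule LIMSEQ_unique[OF lim]) (intro tendsto_power z)
  then have pz: "p = orbit z" by (intro bcontfun_eqI) (simp add: orbit_apply[OF z1])
  have "(\<lambda>i. character (c i)) \<longlonglongrightarrow> character z"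
  proof (rule tendsto_dist_iff[THEN iffD2], rule Lim_null_comparison)
    show "(\<lambda>i. dist (x i) p) \<longlonglongrightarrow> 0" by (rule tendsto_dist_iff[THEN iffD1, OF x(2)])
    show "\<forall>\<^sub>F i in sequentially. norm (dist (character (c i)) (character z)) \<le> dist (x i) p"
      using dist_character_le_dist_orbit[OF c1 z1] by (simp add: c(2) pz)
  qed
  then have "character z \<in> closure (character ` C)"
    unfolding closure_sequential by (intro exI[of _ "\<lambda>i. character (c i)"]) (simp add: c(1))
  then show thesis using that z_def z1 pz by blast
qed

text \<open>
  If the circle condition fails, there are points \<open>l i \<noteq> 1\<close> of the circle whose orbits are within
  \<open>1 / (i + 1)\<close> of the orbit of 1.  The set \<open>C\<close> of their finite products is countable, and as
  multiplication by \<open>l i\<close> moves orbits by at most \<open>1 / (i + 1)\<close>, its orbits form a set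
  without isolated points.  The closure of that set is perfect.
\<close>

lemma uncountable_limit_of_orbits:
  assumes not_nss: "\<not> circle_nss n"
  obtains C where "countable C" "C \<subseteq> sphere 0 1" "uncountable (closure (orbit ` C))"
proof -
  have "\<exists>z. cmod z = 1 \<and> (\<forall>k. cmod (z ^ n k - 1) < inverse (real (Suc i))) \<and> z \<noteq> 1" for i
    using not_nss unfolding circle_nss_def by (metis inverse_positive_iff_positive of_nat_0_less_iff zero_less_Suc)
  then obtain l where l: "\<And>i. cmod (l i) = 1" "\<And>i k. cmod (l i ^ n k - 1) < inverse (real (Suc i))" "\<And>i. l i \<noteq> 1"
    by metis
  define C where "C = range (\<lambda>xs. prod_list (map l xs))"
  have C1: "C \<subseteq> sphere 0 1"
  proof -
    have "cmod (prod_list (map l xs)) = 1" for xs by (induction xs) (simp_all add: norm_mult l)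
    then show ?thesis by (auto simp: C_def)
  qed
  have Cl: "l i * c \<in> C" if c: "c \<in> C" for c i
  proof -
    obtain xs where "c = prod_list (map l xs)" using c unfolding C_def by blast
    then have "l i * c = prod_list (map l (i # xs))" by simp
    then show ?thesis unfolding C_def by blast
  qed
  have limpt: "orbit c islimpt orbit ` C" if c: "c \<in> C" for c
    unfolding islimpt_approachable
  proof (intro allI impI)
    fix e :: real assume "e > 0"
    then obtain i where i: "inverse (real (Suc i)) < e" using reals_Archimedean by blast
    have c1: "cmod c = 1" using c C1 by auto
    then have c0: "c \<noteq> 0" by auto
    have lc1: "cmod (l i * c) = 1" by (simp add: norm_mult l c1)
    have "dist (orbit (l i * c)) (orbit c) \<le> inverse (real (Suc i))"
    proof (rule dist_bound)
      fix k
      have "(l i * c) ^ n k - c ^ n k = (l i ^ n k - 1) * c ^ n k" by (simp add: power_mult_distrib algebra_simps)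
      then have "cmod ((l i * c) ^ n k - c ^ n k) = cmod (l i ^ n k - 1)" by (simp add: norm_mult norm_power c1)
      then show "dist (orbit (l i * c) k) (orbit c k) \<le> inverse (real (Suc i))"
        using l(2)[of i k] by (simp add: orbit_apply[OF lc1] orbit_apply[OF c1] dist_norm)
    qed
    moreover have "orbit (l i * c) \<noteq> orbit c"
    proof
      assume "orbit (l i * c) = orbit c"
      then have "orbit (l i * c) 0 = orbit c 0" by simp
      then show False using l(3)[of i] c0 by (simp add: orbit_apply[OF lc1] orbit_apply[OF c1] n_0)
    qed
    ultimately show "\<exists>x'\<in>orbit ` C. x' \<noteq> orbit c \<and> dist x' (orbit c) < e"
      using Cl[OF c] i by (intro bexI[of _ "orbit (l i * c)"]) auto
  qed
  let ?P = "closure (orbit ` C)"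
  have derived: "euclidean derived_set_of A = {x. x islimpt A}" for A :: "cseq set"
    unfolding derived_set_of_def islimpt_def by auto
  have "x islimpt ?P" if "x \<in> ?P" for x
    using that limpt islimpt_subset[OF _ closure_subset] unfolding closure_def by blast
  then have "euclidean derived_set_of ?P = ?P"
    using closed_limpt[of ?P] closed_closure unfolding derived by blast
  moreover have "?P \<noteq> {}" by (simp add: C_def)
  ultimately have "(UNIV :: real set) \<lesssim> ?P"
    using lepoll_perfect_set[of euclidean ?P] Met_TC.completely_metrizable_space_mtopology complete_UNIV_bcontfun
    by fastforce
  then have "uncountable ?P"
    using countable_lepoll uncountable_UNIV_real by blast
  moreover have "countable C" by (simp add: C_def)
  ultimately show thesis using that C1 by blast
qed

text \<open>
  Linear combinations as lists of coefficients and points: addition is concatenation, and countably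
  many coefficients and points give countably many combinations.
\<close>

definition comb :: "(complex \<times> complex) list \<Rightarrow> cseq" where
  "comb xs = sum_list (map (\<lambda>(c, z). cscale c (character z)) xs)"

definition combs :: "complex set \<Rightarrow> complex set \<Rightarrow> cseq set" where
  "combs Q C = comb ` lists (Q \<times> C)"

lemma comb_append: "comb (xs @ ys) = comb xs + comb ys"
  by (simp add: comb_def)

lemma combs_add: "\<lbrakk>x \<in> combs Q C; y \<in> combs Q C\<rbrakk> \<Longrightarrow> x + y \<in> combs Q C"
proof -
  assume "x \<in> combs Q C" "y \<in> combs Q C"
  then obtain xs ys where "xs \<in> lists (Q \<times> C)" "ys \<in> lists (Q \<times> C)" "x = comb xs" "y = comb ys"
    unfolding combs_def by blast
  then have "xs @ ys \<in> lists (Q \<times> C)" "x + y = comb (xs @ ys)" by (simp_all add: comb_append)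
  then show "x + y \<in> combs Q C" unfolding combs_def by blast
qed

lemma zero_in_combs: "0 \<in> combs Q C"
  unfolding combs_def by (rule image_eqI[of _ _ "[]"]) (simp_all add: comb_def)

lemma closure_combs_add:
  assumes "x \<in> closure (combs Q C)" "y \<in> closure (combs Q C)"
  shows "x + y \<in> closure (combs Q C)"
proof -
  obtain f g where "\<And>i. f i \<in> combs Q C" "f \<longlonglongrightarrow> x" "\<And>i. g i \<in> combs Q C" "g \<longlonglongrightarrow> y"
    using assms unfolding closure_sequential by blast
  then show ?thesis unfolding closure_sequential
    by (intro exI[of _ "\<lambda>i. f i + g i"]) (auto intro: combs_add tendsto_add)
qed

text \<open>
  Scalar multiplications and the shift act diagonally on the characters, so they preserve the
  closed span.
\<close>

lemma closure_combs_image: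
  assumes f: "bounded_linear f" and step: "\<And>c z. z \<in> C \<Longrightarrow> \<exists>d. f (cscale c (character z)) = cscale d (character z)"
    and x: "x \<in> closure (combs UNIV C)"
  shows "f x \<in> closure (combs UNIV C)"
proof -
  interpret bounded_linear f by (rule f)
  define d where "d c z = (SOME d. f (cscale c (character z)) = cscale d (character z))" for c z
  have d: "f (cscale c (character z)) = cscale (d c z) (character z)" if "z \<in> C" for c z
    unfolding d_def by (rule someI_ex[OF step[OF that]])
  have "f (comb xs) = comb (map (\<lambda>(c, z). (d c z, z)) xs)" if "xs \<in> lists (UNIV \<times> C)" for xs
    using that by (induction xs) (auto simp: comb_def zero add d)
  moreover have "map (\<lambda>(c, z). (d c z, z)) xs \<in> lists (UNIV \<times> C)" if "xs \<in> lists (UNIV \<times> C)" for xs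
    using that by (induction xs) auto
  ultimately have "f ` combs UNIV C \<subseteq> combs UNIV C" unfolding combs_def by auto
  then show ?thesis
    using closure_bounded_linear_image_subset[OF f, of "combs UNIV C"] x closure_mono by blast
qed

lemma closure_combs_cscale:
  "x \<in> closure (combs UNIV C) \<Longrightarrow> cscale c x \<in> closure (combs UNIV C)"
proof (rule closure_combs_image[OF bounded_linear_cscale_right])
  fix d z
  have "cscale c (cscale d (character z)) = cscale (c * d) (character z)" by (rule bcontfun_eqI) simp
  then show "\<exists>e. cscale c (cscale d (character z)) = cscale e (character z)" by blast
qed

lemma closure_combs_shift:
  assumes "C \<subseteq> sphere 0 1" "x \<in> closure (combs UNIV C)"
  shows "shift x \<in> closure (combs UNIV C)"
proof (rule closure_combs_image[OF bounded_linear_shift _ assms(2)])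
  fix d z assume "z \<in> C"
  then have "shift (cscale d (character z)) = cscale (d * z) (character z)"
    using assms(1) by (auto simp: shift_cscale shift_character intro!: bcontfun_eqI)
  then show "\<exists>e. shift (cscale d (character z)) = cscale e (character z)" by blast
qed

lemma character_in_combs: "z \<in> C \<Longrightarrow> character z \<in> combs UNIV C"
  unfolding combs_def
  by (rule image_eqI[of _ _ "[(1, z)]"]) (auto simp: comb_def intro!: bcontfun_eqI)

lemma combs_countable_dense:
  assumes "countable C"
  obtains D where "countable D" "D \<subseteq> closure (combs UNIV C)" "closure (combs UNIV C) \<subseteq> closure D"
proof -
  obtain Q :: "complex set" where Q: "countable Q" "\<And>S. open S \<Longrightarrow> S \<noteq> {} \<Longrightarrow> \<exists>q\<in>Q. q \<in> S"
    by (rule countable_dense_setE) blast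
  have dense: "closure Q = UNIV"
  proof -
    have "x \<in> closure Q" for x
      unfolding closure_iff_nhds_not_empty using Q(2) by blast
    then show ?thesis by blast
  qed
  have "comb xs \<in> closure (combs Q C)" if "xs \<in> lists (UNIV \<times> C)" for xs
    using that
  proof (induction xs)
    case Nil
    then show ?case using zero_in_combs[of Q C] closure_subset by (auto simp: comb_def)
  next
    case (Cons p xs)
    obtain c z where p: "p = (c, z)" "z \<in> C" using Cons by auto
    have "(\<lambda>c. cscale c (character z)) ` Q \<subseteq> combs Q C"
    proof
      fix y assume "y \<in> (\<lambda>c. cscale c (character z)) ` Q"
      then obtain q where "q \<in> Q" "y = comb [(q, z)]" by (auto simp: comb_def)
      then show "y \<in> combs Q C" unfolding combs_def using p by auto
    qed
    then have "(\<lambda>c. cscale c (character z)) ` closure Q \<subseteq> closure (combs Q C)"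
      using closure_bounded_linear_image_subset[OF bounded_linear_cscale_left[of "character z"], of Q] closure_mono by blast
    then have "cscale c (character z) \<in> closure (combs Q C)" using dense by blast
    then have "cscale c (character z) + comb xs \<in> closure (combs Q C)"
      by (intro closure_combs_add Cons)
    then show ?case by (simp add: comb_def p)
  qed
  then have "combs UNIV C \<subseteq> closure (combs Q C)" unfolding combs_def by blast
  then have "closure (combs UNIV C) \<subseteq> closure (combs Q C)" by (simp add: closure_minimal)
  moreover have "combs Q C \<subseteq> closure (combs UNIV C)"
  proof -
    have "lists (Q \<times> C) \<subseteq> lists (UNIV \<times> C)" by (rule lists_mono) auto
    then have "combs Q C \<subseteq> combs UNIV C" unfolding combs_def by (rule image_mono)
    then show ?thesis by (rule order_trans[OF _ closure_subset])
  qed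
  moreover have "countable (combs Q C)" unfolding combs_def using assms Q by simp
  ultimately show thesis using that by blast
qed

text \<open>
  The shift on the closed span of the characters of \<open>C\<close>, copied into the given type.  Every limit of
  orbits of \<open>C\<close> contributes an eigenvalue, since its character is a limit of characters of \<open>C\<close>.
\<close>

lemma not_jamison_if_not_circle_nss:
  fixes j :: "cseq \<Rightarrow> 'b"
  assumes not_nss: "\<not> circle_nss n" and j: "inj j"
  shows "\<not> jamison_sequence TYPE('b) n"
proof
  assume jam: "jamison_sequence TYPE('b) n"
  obtain C where C: "countable C" "C \<subseteq> sphere 0 1" "uncountable (closure (orbit ` C))"
    using uncountable_limit_of_orbits[OF not_nss] by blast
  define S where "S = closure (combs UNIV C)"
  interpret S: complex_subspace S cscale j
  proof
    show "0 \<in> S" unfolding S_def using zero_in_combs closure_subset by blast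
    show "x + y \<in> S" if "x \<in> S" "y \<in> S" for x y using that unfolding S_def by (rule closure_combs_add)
    show "cscale c x \<in> S" if "x \<in> S" for c x using that unfolding S_def by (rule closure_combs_cscale)
    show "complete S" unfolding S_def
      by (rule complete_closed_subset[OF closed_closure subset_UNIV complete_UNIV_bcontfun])
  qed (auto intro!: bcontfun_eqI j simp: norm_cscale algebra_simps)
  define E where "E = S.copy (\<lambda>x y. 0) 0"
  define T where "T = (\<lambda>x. j (shift (inv_into UNIV j x)))"
  have T_j [simp]: "T (j y) = j (shift y)" for y by (simp add: T_def)
  have Tk: "(T ^^ k) (j y) = j ((shift ^^ k) y)" for k y by (induction k) simp_all
  have E_simps [simp]: "carrier E = j ` S" "add E (j x) (j y) = j (x + y)" "zero E = j 0"
    "module.smult E c (j x) = j (cscale c x)" for x y c by (simp_all add: E_def)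
  have shift_S: "shift x \<in> S" if "x \<in> S" for x
    using closure_combs_shift[OF C(2)] that by (simp add: S_def)
  interpret shift: bounded_linear shift by (rule bounded_linear_shift)
  have "countable {c \<in> eigenvalues E T. cmod c = 1}"
  proof (rule jam[unfolded jamison_sequence_def, rule_format], intro conjI)
    show "banach_space E S.copy_norm" unfolding E_def by (rule S.banach_space_copy)
    obtain D where "countable D" "D \<subseteq> S" "S \<subseteq> closure D"
      unfolding S_def by (rule combs_countable_dense[OF C(1)])
    then show "separable_space (norm_topology E S.copy_norm)" unfolding E_def by (rule S.separable_space_copy)
    show "bounded_linear_operator E S.copy_norm T"
      unfolding bounded_linear_operator_def
    proof (intro conjI)
      show "\<exists>C. \<forall>x\<in>carrier E. S.copy_norm (T x) \<le> C * S.copy_norm x"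
        using norm_funpow_shift_le[of 0] by (intro exI[of _ 2]) (auto simp: n_0)
    qed (auto simp: shift_S shift.add shift_cscale)
    show "bdd_above (range (\<lambda>k. operator_norm E S.copy_norm (T ^^ n k)))"
    proof (rule bdd_aboveI2)
      fix k
      show "operator_norm E S.copy_norm (T ^^ n k) \<le> 2"
        unfolding operator_norm_def
      proof (rule cSUP_least)
        show "carrier E \<noteq> {}" using S.S_zero by auto
        fix x assume "x \<in> carrier E"
        then obtain y where "x = j y" by auto
        then show "S.copy_norm ((T ^^ n k) x) / S.copy_norm x \<le> 2"
          using norm_funpow_shift_le[of k y] by (cases "y = 0") (auto simp: Tk divide_le_eq)
      qed
    qed
  qed
  moreover have "(\<lambda>p :: cseq. p 0) ` closure (orbit ` C) \<subseteq> {c \<in> eigenvalues E T. cmod c = 1}"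
  proof
    fix z assume "z \<in> (\<lambda>p :: cseq. p 0) ` closure (orbit ` C)"
    then obtain p where p: "p \<in> closure (orbit ` C)" "z = p 0" by blast
    then have z: "cmod z = 1" "character z \<in> closure (character ` C)" using limit_of_orbits[OF C(2) p(1)] by metis+
    have "character ` C \<subseteq> combs UNIV C" using character_in_combs by blast
    then have "character z \<in> S" unfolding S_def using z(2) closure_mono by blast
    then have "j (character z) \<in> carrier E" "j (character z) \<noteq> \<zero>\<^bsub>E\<^esub>" "T (j (character z)) = z \<odot>\<^bsub>E\<^esub> j (character z)"
      using z(1) by (auto simp: character_nonzero shift_character)
    then show "z \<in> {c \<in> eigenvalues E T. cmod c = 1}" using z(1) unfolding eigenvalues_def by blast
  qed
  moreover have "inj_on (\<lambda>p :: cseq. p 0) (closure (orbit ` C))"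
    by (rule inj_onI) (metis limit_of_orbits[OF C(2)])
  ultimately show False using C(3) countable_image_inj_on countable_subset by blast
qed

end

text \<open>
  A complex sequence is determined by the set of rationals below each real and imaginary part.
  This set lives in a countable type, so there are at most continuum many sequences.
\<close>

lemma inj_cseq_into_real: "\<exists>f :: cseq \<Rightarrow> real. inj f"
proof -
  define part where "part b z = (if b then Re z else Im z)" for b z
  define g :: "cseq \<Rightarrow> nat set" where
    "g y = to_nat ` {(k :: nat, b, q :: rat). of_rat q < part b (y k)}" for y
  have "inj g"
  proof (rule injI)
    fix x y assume "g x = g y"
    then have eq: "{(k :: nat, b, q :: rat). of_rat q < part b (x k)} = {(k, b, q). of_rat q < part b (y k)}"
      unfolding g_def by (simp add: inj_image_eq_iff)
    have "part b (x k) = part b (y k)" for b k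
    proof (rule ccontr)
      assume "part b (x k) \<noteq> part b (y k)"
      then consider "part b (x k) < part b (y k)" | "part b (y k) < part b (x k)" by linarith
      then show False
      proof cases
        case 1
        then obtain q where "part b (x k) < of_rat q" "of_rat q < part b (y k)" using of_rat_dense by blast
        then have "(k, b, q) \<in> {(k, b, q). of_rat q < part b (y k)}" "(k, b, q) \<notin> {(k, b, q). of_rat q < part b (x k)}"
          by auto
        then show False using eq by blast
      next
        case 2
        then obtain q where "part b (y k) < of_rat q" "of_rat q < part b (x k)" using of_rat_dense by blast
        then have "(k, b, q) \<in> {(k, b, q). of_rat q < part b (x k)}" "(k, b, q) \<notin> {(k, b, q). of_rat q < part b (y k)}"
          by auto
        then show False using eq by blast
      qed
    qed
    from this[of True] this[of False] show "x = y"
      by (intro bcontfun_eqI complex_eqI) (simp_all add: part_def)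
  qed
  moreover obtain h :: "nat set \<Rightarrow> real" where "inj h"
    using eqpoll_imp_lepoll[OF nat_sets_eqpoll_reals] unfolding lepoll_def by auto
  ultimately show ?thesis using inj_compose by blast
qed

theorem corollary2p5:
  fixes n :: "nat \<Rightarrow> nat"
  assumes "strict_mono n" and "\<forall>k. 0 < n k" and "n 0 = 1"
    and group_universe: "(UNIV :: real set) \<lesssim> (UNIV :: 'g set)"
    and algebra_universe: "(UNIV :: real set) \<lesssim> (UNIV :: 'a set)"
    and space_universe: "(UNIV :: real set) \<lesssim> (UNIV :: 'b set)"
  shows "nss_for_linear_banach_lie_groups TYPE('g) TYPE('a) n \<longleftrightarrow>
         jamison_sequence TYPE('b) n"
proof -
  obtain r :: "cseq \<Rightarrow> real" where r: "inj r" using inj_cseq_into_real by blast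
  have const: "inj (const_bcontfun :: complex \<Rightarrow> cseq)"
    by (rule injI) (metis const_bcontfun.rep_eq)
  obtain g :: "real \<Rightarrow> 'g" and a :: "real \<Rightarrow> 'a" and b :: "real \<Rightarrow> 'b" where gab: "inj g" "inj a" "inj b"
    using group_universe algebra_universe space_universe unfolding lepoll_def by auto
  define h where "h = g \<circ> r \<circ> const_bcontfun"
  define i where "i = a \<circ> r \<circ> const_bcontfun"
  have h: "inj h" and i: "inj i" unfolding h_def i_def using gab r const by (auto intro!: inj_compose)
  have "circle_nss n" if "nss_for_linear_banach_lie_groups TYPE('g) TYPE('a) n"
    using that nss_circle_copy[OF h] linear_banach_lie_group_circle_copy[OF h i]
    unfolding nss_for_linear_banach_lie_groups_def circle_nss_def by blast
  moreover have "circle_nss n" if "jamison_sequence TYPE('b) n"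
  proof (rule ccontr)
    assume "\<not> circle_nss n"
    moreover interpret unit_first_sequence n by unfold_locales (rule assms)
    have "inj (b \<circ> r)" using gab r by (intro inj_compose)
    ultimately show False using not_jamison_if_not_circle_nss that by blast
  qed
  ultimately show ?thesis
    using circle_nss_imp_nss_for_linear_banach_lie_groups[OF assms(1)] circle_nss_imp_jamison_sequence by blast
qed

end
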